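(* The following two statements are equivalent: (a) The Jacobian conjecture holds for all $n\ge 1$; that is, for every $n\ge 1$, every polynomial map $F:\mathbb{C}^n\to\mathbb{C}^n$ whose Jacobian determinant is identically $1$ is an automorphism of $\mathbb{C}^n$ (i.e. has a polynomial inverse). (b) For every $n\ge 1$ and all homogeneous polynomials $H_i(z)\in\mathbb{C}[z]=\mathbb{C}[z_1,\dots,z_n]$ ($1\le i\le n$) of degree $3$, the image conjecture holds for $f(\xi,z)=\sum_{i=1}^n\xi_iH_i(z)$ and $g(z)=z_j$ for each $1\le j\le n$; that is, if $f^m\in\operatorname{Im}\Theta$ for each $m\ge 1$, then for each $1\le j\le n$ one has $f^m z_j\in\operatorname{Im}\Theta$ for all sufficiently large $m$.
   Context: Here $z=(z_1,\dots,z_n)$ and $\xi=(\xi_1,\dots,\xi_n)$ are commuting free variables, $\mathbb{C}[\xi,z]$ is the polynomial algebra, $\partial_i:=\partial/\partial z_i$, $\Theta_i:=\xi_i-\partial_i$ ($1\le i\le n$) is regarded as a differential operator of $\mathbb{C}[\xi,z]$, $\Theta:=\{\Theta_1,\dots,\Theta_n\}$, and $\operatorname{Im}\Theta:=\sum_{i=1}^n\Theta_i(\mathbb{C}[\xi,z])$. The zero polynomial is regarded as homogeneous of every degree. *)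

theory Defs
  imports "HOL-Library.Poly_Mapping" "Jordan_Normal_Form.Determinant"
begin

text \<open>
  For fixed \<open>n\<close> the variables are \<open>Xi i\<close> and \<open>Zv i\<close> with \<open>i < n\<close>; indices run over
  \<open>0, \<dots>, n - 1\<close>, as in the matrix library. A monomial is a finitely supported exponent
  function, and a polynomial is a finitely supported function from monomials to coefficients,
  with the convolution product of finitely supported functions.
\<close>

datatype pvar = Xi nat | Zv nat

type_synonym monom = "pvar \<Rightarrow>\<^sub>0 nat"
type_synonym cpoly = "monom \<Rightarrow>\<^sub>0 complex"

definition var :: "pvar \<Rightarrow> cpoly" where
  "var v = Poly_Mapping.single (Poly_Mapping.single v 1) 1"

definition polys_in :: "pvar set \<Rightarrow> cpoly set" where
  "polys_in V = {p. \<forall>m \<in> Poly_Mapping.keys p. Poly_Mapping.keys m \<subseteq> V}"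

text \<open>\<open>\<complex>[z]\<close> is taken as a subring of \<open>\<complex>[\<xi>,z]\<close>.\<close>

definition polys_z :: "nat \<Rightarrow> cpoly set" where
  "polys_z n = polys_in (Zv ` {..<n})"

definition polys_xi_z :: "nat \<Rightarrow> cpoly set" where
  "polys_xi_z n = polys_in (Xi ` {..<n} \<union> Zv ` {..<n})"

definition monom_degree :: "monom \<Rightarrow> nat" where
  "monom_degree m = (\<Sum>v \<in> Poly_Mapping.keys m. Poly_Mapping.lookup m v)"

text \<open>The zero polynomial is homogeneous of every degree.\<close>

definition homogeneous :: "nat \<Rightarrow> cpoly \<Rightarrow> bool" where
  "homogeneous d p \<longleftrightarrow> (\<forall>m \<in> Poly_Mapping.keys p. monom_degree m = d)"

text \<open>
  The exponent subtraction below is truncated, but wherever it truncates, the new coefficient is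
  \<open>0\<close>.
\<close>

definition pdiff :: "pvar \<Rightarrow> cpoly \<Rightarrow> cpoly" where
  "pdiff v p = (\<Sum>m \<in> Poly_Mapping.keys p.
     Poly_Mapping.single (m - Poly_Mapping.single v 1)
       (of_nat (Poly_Mapping.lookup m v) * Poly_Mapping.lookup p m))"

definition eval_poly :: "(pvar \<Rightarrow> complex) \<Rightarrow> cpoly \<Rightarrow> complex" where
  "eval_poly a p = (\<Sum>m \<in> Poly_Mapping.keys p.
     Poly_Mapping.lookup p m * (\<Prod>v \<in> Poly_Mapping.keys m. a v ^ Poly_Mapping.lookup m v))"

text \<open>
  The polynomial map \<open>\<complex>\<^sup>n \<rightarrow> \<complex>\<^sup>n\<close> with components \<open>P 0, \<dots>, P (n - 1)\<close> in \<open>\<complex>[z]\<close>, where \<open>\<complex>\<^sup>n\<close> is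
  \<^term>\<open>carrier_vec n :: complex vec set\<close>. The value given to the variables \<open>\<xi>\<close> is immaterial,
  as they do not occur in elements of \<open>\<complex>[z]\<close>.
\<close>

definition poly_map :: "nat \<Rightarrow> (nat \<Rightarrow> cpoly) \<Rightarrow> complex vec \<Rightarrow> complex vec" where
  "poly_map n P x = vec n (\<lambda>i. eval_poly (\<lambda>v. case v of Xi j \<Rightarrow> 0 | Zv j \<Rightarrow> x $ j) (P i))"

definition jacobian_det :: "nat \<Rightarrow> (nat \<Rightarrow> cpoly) \<Rightarrow> cpoly" where
  "jacobian_det n P = det (mat n n (\<lambda>(i, j). pdiff (Zv j) (P i)))"

definition poly_automorphism :: "nat \<Rightarrow> (nat \<Rightarrow> cpoly) \<Rightarrow> bool" where
  "poly_automorphism n P \<longleftrightarrow> (\<exists>Q. (\<forall>i<n. Q i \<in> polys_z n) \<and>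
     (\<forall>x \<in> carrier_vec n. poly_map n Q (poly_map n P x) = x \<and>
                           poly_map n P (poly_map n Q x) = x))"

definition jacobian_conjecture :: "nat \<Rightarrow> bool" where
  "jacobian_conjecture n \<longleftrightarrow>
     (\<forall>P. (\<forall>i<n. P i \<in> polys_z n) \<and> jacobian_det n P = 1 \<longrightarrow> poly_automorphism n P)"

definition Theta :: "nat \<Rightarrow> cpoly \<Rightarrow> cpoly" where
  "Theta i p = var (Xi i) * p - pdiff (Zv i) p"

definition Im_Theta :: "nat \<Rightarrow> cpoly set" where
  "Im_Theta n = {\<Sum>i<n. Theta i (p i) | p. \<forall>i<n. p i \<in> polys_xi_z n}"

definition image_conjecture_for :: "nat \<Rightarrow> cpoly \<Rightarrow> cpoly \<Rightarrow> bool" where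
  "image_conjecture_for n f g \<longleftrightarrow>
     ((\<forall>m\<ge>1. f ^ m \<in> Im_Theta n) \<longrightarrow> (\<exists>N. \<forall>m\<ge>N. f ^ m * g \<in> Im_Theta n))"

end

theory Submission
  imports Defs
begin

text \<open>
  Write \<open>F = z - H\<close>, \<open>f = \<Sum>\<^sub>i \<xi>\<^sub>i H\<^sub>i\<close>, and let \<open>\<E>\<close> be the linear map sending \<open>\<xi>\<^sup>\<alpha> h(z)\<close> to
  \<open>\<partial>\<^sup>\<alpha> h\<close>. Since \<open>\<E>(\<xi>\<^sub>i p) = \<partial>\<^sub>i \<E>(p) = \<E>(\<partial>\<^sub>i p)\<close>, and since \<open>p\<close> and \<open>\<E>(p)\<close> differ by an element
  of \<open>Im \<Theta>\<close>, the image \<open>Im \<Theta>\<close> is the kernel of \<open>\<E>\<close> (\<open>Im_Theta_iff\<close>).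

  The heart of the proof is a form of the inversion formula of Abhyankar and Gurjar. For \<open>u\<close> in
  \<open>\<complex>[z]\<close> put \<open>A\<^sub>m(u) = \<E>(f\<^sup>m u) / m!\<close>. When \<open>H\<close> is homogeneous of degree 3, \<open>A\<^sub>m\<close> raises degrees by
  \<open>2m\<close>, so \<open>\<A> = \<Sum>\<^sub>m A\<^sub>m\<close> makes sense as a map to formal power series, and it is injective because
  \<open>A\<^sub>0\<close> is the identity. The rules for \<open>\<E>\<close> give \<open>\<Sum>\<^sub>i \<partial>\<^sub>i \<A>(u \<partial>\<^sub>j F\<^sub>i) = \<A>(\<partial>\<^sub>j u)\<close>. Contracting with
  the adjugate \<open>N\<close> of the Jacobian matrix, whose columns have divergence zero (\<open>piola\<close>), yields
  \<open>\<partial>\<^sub>k \<A>(u J) = \<A>(D\<^sub>k u)\<close> with the derivations \<open>D\<^sub>k = \<Sum>\<^sub>j N\<^sub>j\<^sub>k \<partial>\<^sub>j\<close> and the Jacobian determinant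
  \<open>J\<close> (\<open>a_D\<close>). For \<open>u = 1\<close> this says \<open>\<A>(J) = 1\<close>, so by injectivity \<open>J = 1\<close> if and only if
  \<open>\<A>(1) = 1\<close>, that is, if and only if \<open>f\<^sup>m\<close> lies in \<open>Im \<Theta>\<close> for all \<open>m \<ge> 1\<close>
  (\<open>jacobian_eq_1_iff\<close>). If \<open>J = 1\<close>, then \<open>\<A>\<close> intertwines the derivations \<open>D\<^sub>k\<close> and \<open>\<partial>\<^sub>k\<close> and
  preserves constant terms; hence it is multiplicative (\<open>a_mult\<close>) and sends \<open>F\<^sub>j\<close> to \<open>z\<^sub>j\<close>. So \<open>\<A>\<close>
  is the substitution of the formal inverse \<open>G\<close> of \<open>F\<close>, and \<open>G\<^sub>j = \<A>(z\<^sub>j)\<close> is a polynomial if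
  and only if \<open>A\<^sub>m(z\<^sub>j) = 0\<close>, i.e. \<open>f\<^sup>m z\<^sub>j \<in> Im \<Theta>\<close>, for all large \<open>m\<close>. Therefore the second statement
  of the theorem says exactly that the Jacobian conjecture holds for all maps \<open>z - H\<close> with \<open>H\<close>
  homogeneous of degree 3 (\<open>image_conjecture_iff\<close>).

  The remaining part is the reduction of the Jacobian conjecture to such maps, due to Bass, Connell,
  Wright and Yagzhev (\<open>cubic_reduction\<close>). An affine change of coordinates makes the map tangent to
  the identity. A monomial \<open>P Q\<close> of degree at least 4 in a component is removed by adding two variables
  \<open>y\<^sub>1, y\<^sub>2\<close> and composing with the elementary maps \<open>y\<^sub>1 \<mapsto> y\<^sub>1 + P\<close>, \<open>y\<^sub>2 \<mapsto> y\<^sub>2 + Q\<close> and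
  \<open>z\<^sub>i \<mapsto> z\<^sub>i - y\<^sub>1 y\<^sub>2\<close>, which replaces it by monomials of lower degree (\<open>degree_reduction\<close>). A map
  \<open>z + P + C\<close> with quadratic \<open>P\<close> and cubic \<open>C\<close> is homogenised with one variable \<open>t\<close> to
  \<open>z + t P + t\<^sup>2 C\<close>, and the terms \<open>t\<^sup>2 C\<close> are traded for \<open>t\<^sup>2 y\<close> and \<open>C\<close> in the same way, with \<open>n\<close>
  further variables \<open>y\<close> (\<open>quadratic_cubic_invertible\<close>).

  Polynomial maps are handled as substitution endomorphisms; they agree with maps on \<open>\<complex>\<^sup>n\<close> since
  a polynomial that vanishes everywhere is zero (\<open>poly_automorphism_iff\<close>).
\<close>

section \<open>The polynomial ring\<close>

text \<open>
  The order on the variables has no meaning of its own: a linear order on the variables yields one on the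
  monomials, and with it the instance of \<^typ>\<open>cpoly\<close> as an integral domain.
\<close>
instantiation pvar :: linorder
begin

definition pvar_code :: "pvar \<Rightarrow> nat" where
  "pvar_code v = (case v of Xi j \<Rightarrow> 2 * j | Zv j \<Rightarrow> 2 * j + 1)"

definition less_eq_pvar :: "pvar \<Rightarrow> pvar \<Rightarrow> bool" where
  "v \<le> w \<longleftrightarrow> pvar_code v \<le> pvar_code w"

definition less_pvar :: "pvar \<Rightarrow> pvar \<Rightarrow> bool" where
  "v < w \<longleftrightarrow> pvar_code v < pvar_code w"

lemma pvar_code_inject: "pvar_code v = pvar_code w \<Longrightarrow> v = w"
  unfolding pvar_code_def by (cases v; cases w; simp; presburger)

instance
  by standard (auto simp: less_eq_pvar_def less_pvar_def intro: pvar_code_inject)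

end

lemma poly_mapping_expand:
  "p = (\<Sum>m\<in>Poly_Mapping.keys p. Poly_Mapping.single m (Poly_Mapping.lookup p m))"
proof (rule poly_mapping_eqI)
  fix k
  show "Poly_Mapping.lookup p k =
      Poly_Mapping.lookup (\<Sum>m\<in>Poly_Mapping.keys p. Poly_Mapping.single m (Poly_Mapping.lookup p m)) k"
    by (auto simp: lookup_sum lookup_single when_def in_keys_iff)
qed

lemma additive_induct [case_names single add]:
  fixes p :: "'a \<Rightarrow>\<^sub>0 'b::comm_monoid_add"
  assumes "\<And>m c. P (Poly_Mapping.single m c)" "\<And>p q. P p \<Longrightarrow> P q \<Longrightarrow> P (p + q)"
  shows "P p"
proof -
  have "P (\<Sum>m\<in>A. Poly_Mapping.single m (Poly_Mapping.lookup p m))" if "finite A" for A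
    using that
  proof (induction A rule: finite_induct)
    case empty
    \<comment> \<open>The zero polynomial is a monomial with coefficient zero.\<close>
    show ?case using assms(1)[of undefined 0] by simp
  qed (simp add: assms)
  from this[of "Poly_Mapping.keys p"] show ?thesis by (simp flip: poly_mapping_expand)
qed

text \<open>
  Constants, as elements of the polynomial ring.
\<close>
definition cst :: "complex \<Rightarrow> cpoly" where
  "cst c = Poly_Mapping.single 0 c"

lemma comm_ring_hom_cst: "comm_ring_hom cst"
  by unfold_locales (simp_all add: cst_def single_add mult_single)

lemma cst_simps [simp]: "cst 0 = 0" "cst 1 = 1"
  by (simp_all add: cst_def)

lemma cst_mult_single: "cst c * Poly_Mapping.single m d = Poly_Mapping.single m (c * d)"
  by (simp add: cst_def mult_single)

lemma var_power: "var v ^ k = Poly_Mapping.single (Poly_Mapping.single v k) 1"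
  by (induction k) (simp_all add: var_def mult_single add.commute flip: single_add)

lemma single_sum_eq_prod:
  "finite A \<Longrightarrow> Poly_Mapping.single (\<Sum>v\<in>A. g v) (1::'b::comm_semiring_1) = (\<Prod>v\<in>A. Poly_Mapping.single (g v) 1)"
proof (induction A rule: finite_induct)
  case (insert x A)
  then show ?case by (simp add: mult_single flip: insert.IH)
qed simp

lemma single_eq_prod:
  "Poly_Mapping.single m c = cst c * (\<Prod>v\<in>Poly_Mapping.keys m. var v ^ Poly_Mapping.lookup m v)"
proof -
  have "Poly_Mapping.single m (1::complex) = (\<Prod>v\<in>Poly_Mapping.keys m. var v ^ Poly_Mapping.lookup m v)"
    by (subst poly_mapping_expand[of m]) (simp add: single_sum_eq_prod var_power)
  then show ?thesis by (metis cst_mult_single mult.right_neutral)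
qed

section \<open>Polynomials in a set of variables\<close>

lemma polys_in_mono: "V \<subseteq> W \<Longrightarrow> polys_in V \<subseteq> polys_in W"
  by (auto simp: polys_in_def)

lemma polys_in_UNIV [simp]: "p \<in> polys_in UNIV"
  by (simp add: polys_in_def)

lemma polys_in_cst [simp]: "cst c \<in> polys_in V"
  by (auto simp: polys_in_def cst_def)

lemma polys_in_01 [simp]: "0 \<in> polys_in V" "1 \<in> polys_in V"
  by (auto simp: polys_in_def)

lemma polys_in_var [simp]: "var v \<in> polys_in V \<longleftrightarrow> v \<in> V"
  by (auto simp: polys_in_def var_def)

lemma polys_in_add: "p \<in> polys_in V \<Longrightarrow> q \<in> polys_in V \<Longrightarrow> p + q \<in> polys_in V"
  using keys_add[of p q] by (auto simp: polys_in_def)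

lemma polys_in_uminus: "p \<in> polys_in V \<Longrightarrow> - p \<in> polys_in V"
  by (auto simp: polys_in_def in_keys_iff)

lemma polys_in_diff: "p \<in> polys_in V \<Longrightarrow> q \<in> polys_in V \<Longrightarrow> p - q \<in> polys_in V"
  using polys_in_add[of p V "- q"] polys_in_uminus by simp

lemma keys_add_nat: "Poly_Mapping.keys (a + b :: monom) = Poly_Mapping.keys a \<union> Poly_Mapping.keys b"
  by (auto simp: in_keys_iff lookup_add)

lemma polys_in_mult: "p \<in> polys_in V \<Longrightarrow> q \<in> polys_in V \<Longrightarrow> p * q \<in> polys_in V"
  using keys_mult[of p q] unfolding polys_in_def by (fastforce simp: keys_add_nat)

lemma polys_in_sum: "(\<And>i. i \<in> A \<Longrightarrow> f i \<in> polys_in V) \<Longrightarrow> sum f A \<in> polys_in V"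
  by (induction A rule: infinite_finite_induct) (auto intro: polys_in_add)

lemma polys_in_prod: "(\<And>i. i \<in> A \<Longrightarrow> f i \<in> polys_in V) \<Longrightarrow> prod f A \<in> polys_in V"
  by (induction A rule: infinite_finite_induct) (auto intro: polys_in_mult)

lemma polys_in_power: "p \<in> polys_in V \<Longrightarrow> p ^ k \<in> polys_in V"
  by (induction k) (auto intro: polys_in_mult)

lemmas polys_in_closed = polys_in_add polys_in_uminus polys_in_diff polys_in_mult polys_in_sum
  polys_in_prod polys_in_power

lemma polys_in_induct [consumes 1, case_names cst var add mult]:
  assumes p: "p \<in> polys_in V"
    and cst: "\<And>c. P (cst c)" and var: "\<And>v. v \<in> V \<Longrightarrow> P (var v)"
    and add: "\<And>p q. p \<in> polys_in V \<Longrightarrow> q \<in> polys_in V \<Longrightarrow> P p \<Longrightarrow> P q \<Longrightarrow> P (p + q)"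
    and mult: "\<And>p q. p \<in> polys_in V \<Longrightarrow> q \<in> polys_in V \<Longrightarrow> P p \<Longrightarrow> P q \<Longrightarrow> P (p * q)"
  shows "P p"
proof -
  have 1: "var v ^ k \<in> polys_in V \<and> P (var v ^ k)" if "v \<in> V" for v k
    using that cst[of 1] by (induction k) (auto intro!: mult polys_in_mult var)
  have 2: "prod f A \<in> polys_in V \<and> P (prod f A)" if "\<And>i. i \<in> A \<Longrightarrow> f i \<in> polys_in V \<and> P (f i)"
    for f :: "pvar \<Rightarrow> cpoly" and A
    using that cst[of 1]
    by (induction A rule: infinite_finite_induct) (auto intro!: mult polys_in_mult)
  have 3: "Poly_Mapping.single m c \<in> polys_in V \<and> P (Poly_Mapping.single m c)"
    if "m \<in> Poly_Mapping.keys p" for m c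
  proof -
    have "(\<Prod>v\<in>Poly_Mapping.keys m. var v ^ Poly_Mapping.lookup m v) \<in> polys_in V
        \<and> P (\<Prod>v\<in>Poly_Mapping.keys m. var v ^ Poly_Mapping.lookup m v)"
      using p that by (intro 2 1) (auto simp: polys_in_def)
    then show ?thesis unfolding single_eq_prod[of m c]
      by (auto intro!: mult polys_in_mult cst)
  qed
  have "sum f A \<in> polys_in V \<and> P (sum f A)" if "\<And>i. i \<in> A \<Longrightarrow> f i \<in> polys_in V \<and> P (f i)"
    for f :: "monom \<Rightarrow> cpoly" and A
    using that cst[of 0]
    by (induction A rule: infinite_finite_induct) (auto intro!: add polys_in_add)
  from this[of "Poly_Mapping.keys p" "\<lambda>m. Poly_Mapping.single m (Poly_Mapping.lookup p m)"] 3 show ?thesis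
    by (simp flip: poly_mapping_expand)
qed

lemmas cpoly_induct = polys_in_induct[OF polys_in_UNIV, simplified, case_names cst var add mult]

section \<open>Substitution\<close>

text \<open>
  The value of a polynomial when its coefficients are mapped by \<open>h\<close> and its variables by \<open>a\<close>. With
  varying target rings this covers evaluation at a point, substitution of polynomials, and restriction
  to a line.
\<close>
definition psub :: "(complex \<Rightarrow> 'b::comm_ring_1) \<Rightarrow> (pvar \<Rightarrow> 'b) \<Rightarrow> cpoly \<Rightarrow> 'b" where
  "psub h a p = (\<Sum>m\<in>Poly_Mapping.keys p.
     h (Poly_Mapping.lookup p m) * (\<Prod>v\<in>Poly_Mapping.keys m. a v ^ Poly_Mapping.lookup m v))"

lemma eval_poly_eq_psub: "eval_poly a = psub (\<lambda>c. c) a"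
  by (simp add: fun_eq_iff eval_poly_def psub_def)

context
  fixes h :: "complex \<Rightarrow> 'b::comm_ring_1"
  assumes h: "comm_ring_hom h"
begin

interpretation h: comm_ring_hom h by (rule h)

lemma psub_single: "psub h a (Poly_Mapping.single m c) =
    h c * (\<Prod>v\<in>Poly_Mapping.keys m. a v ^ Poly_Mapping.lookup m v)"
  by (cases "c = 0") (simp_all add: psub_def)

lemma psub_add: "psub h a (p + q) = psub h a p + psub h a q"
  unfolding psub_def
  by (rule setsum_keys_plus_distrib
      [where f = "\<lambda>m c. h c * (\<Prod>v\<in>Poly_Mapping.keys m. a v ^ Poly_Mapping.lookup m v)"])
    (simp_all add: h.hom_add ring_distribs)

lemma monom_value_add:
  "(\<Prod>v\<in>Poly_Mapping.keys (m + m'). (a v :: 'b) ^ Poly_Mapping.lookup (m + m' :: monom) v) =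
   (\<Prod>v\<in>Poly_Mapping.keys m. a v ^ Poly_Mapping.lookup m v) *
   (\<Prod>v\<in>Poly_Mapping.keys m'. a v ^ Poly_Mapping.lookup m' v)"
proof -
  let ?A = "Poly_Mapping.keys m \<union> Poly_Mapping.keys m'"
  have *: "(\<Prod>v\<in>Poly_Mapping.keys k. a v ^ Poly_Mapping.lookup k v) = (\<Prod>v\<in>?A. a v ^ Poly_Mapping.lookup k v)"
    if "Poly_Mapping.keys k \<subseteq> ?A" for k
    by (rule prod.mono_neutral_left) (use that in \<open>auto simp: in_keys_iff\<close>)
  show ?thesis
    by (simp add: * keys_add_nat lookup_add power_add prod.distrib)
qed

lemma psub_mult: "psub h a (p * q) = psub h a p * psub h a q"
proof (induction p rule: additive_induct)
  case (single m c)
  show ?case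
  proof (induction q rule: additive_induct)
    case (single m' c')
    show ?case by (simp add: mult_single psub_single h.hom_mult monom_value_add mult_ac)
  qed (simp add: ring_distribs psub_add)
qed (simp add: ring_distribs psub_add)

lemma psub_cst [simp]: "psub h a (cst c) = h c"
  by (simp add: cst_def psub_single)

lemma psub_var [simp]: "psub h a (var v) = a v"
  by (simp add: var_def psub_single)

lemma comm_ring_hom_psub: "comm_ring_hom (psub h a)"
  using psub_cst[of a 0] psub_cst[of a 1]
  by unfold_locales (simp_all add: psub_add psub_mult)

end

section \<open>Partial derivatives\<close>

lemma pdiff_single: "pdiff v (Poly_Mapping.single m c) =
    Poly_Mapping.single (m - Poly_Mapping.single v 1) (of_nat (Poly_Mapping.lookup m v) * c)"
  by (cases "c = 0") (simp_all add: pdiff_def)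

lemma pdiff_add: "pdiff v (p + q) = pdiff v p + pdiff v q"
  unfolding pdiff_def
  by (rule setsum_keys_plus_distrib[where f = "\<lambda>m c. Poly_Mapping.single (m - Poly_Mapping.single v 1)
       (of_nat (Poly_Mapping.lookup m v) * c)"])
    (simp_all add: single_add ring_distribs)

lemma monom_shift:
  "Poly_Mapping.lookup (a::monom) v \<noteq> 0 \<Longrightarrow> a - Poly_Mapping.single v 1 + b = a + b - Poly_Mapping.single v 1"
  by (rule poly_mapping_eqI) (auto simp: lookup_add lookup_minus lookup_single when_def)

lemma pdiff_mult: "pdiff v (p * q) = pdiff v p * q + p * pdiff v q"
proof (induction p rule: additive_induct)
  case (single m c)
  show ?case
  proof (induction q rule: additive_induct)
    case (single m' c')
    have *: "Poly_Mapping.single (k - Poly_Mapping.single v 1 + l) (of_nat (Poly_Mapping.lookup k v) * d :: complex) =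
        Poly_Mapping.single (k + l - Poly_Mapping.single v 1) (of_nat (Poly_Mapping.lookup k v) * d)"
      for k l :: monom and d
      by (cases "Poly_Mapping.lookup k v = 0") (simp_all add: monom_shift del: One_nat_def)
    show ?case
      using *[of m m' "c * c'"] *[of m' m "c * c'"]
      by (simp add: mult_single pdiff_single lookup_add ring_distribs single_add mult_ac add.commute)
  qed (simp add: ring_distribs pdiff_add)
qed (simp add: ring_distribs pdiff_add)

lemma pdiff_cst [simp]: "pdiff v (cst c) = 0"
  by (simp add: cst_def pdiff_single)

lemma pdiff_01 [simp]: "pdiff v 0 = 0" "pdiff v 1 = 0"
  using pdiff_cst[of v 0] pdiff_cst[of v 1] by simp_all

lemma pdiff_var: "pdiff v (var w) = (if v = w then 1 else 0)"
  by (auto simp: var_def pdiff_single lookup_single)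

lemma pdiff_uminus: "pdiff v (- p) = - pdiff v p"
  using pdiff_add[of v p "- p"] by (simp add: eq_neg_iff_add_eq_0 add.commute)

lemma pdiff_diff: "pdiff v (p - q) = pdiff v p - pdiff v q"
  using pdiff_add[of v p "- q"] by (simp add: pdiff_uminus)

lemma pdiff_sum: "pdiff v (sum f A) = (\<Sum>i\<in>A. pdiff v (f i))"
  by (induction A rule: infinite_finite_induct) (simp_all add: pdiff_add)

lemma pdiff_cst_mult: "pdiff v (cst c * p) = cst c * pdiff v p"
  by (simp add: pdiff_mult)

lemma pdiff_power: "pdiff v (p ^ Suc k) = of_nat (Suc k) * (p ^ k * pdiff v p)"
proof (induction k)
  case (Suc k)
  have "pdiff v (p ^ Suc (Suc k)) = pdiff v p * p ^ Suc k + p * pdiff v (p ^ Suc k)"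
    by (simp only: power_Suc[of p "Suc k"] pdiff_mult)
  then show ?case unfolding Suc.IH by (simp add: algebra_simps)
qed simp

lemma pdiff_commute: "pdiff v (pdiff w p) = pdiff w (pdiff v p)"
  by (induction p rule: cpoly_induct) (simp_all add: pdiff_var pdiff_add pdiff_mult)

lemma pdiff_outside: "p \<in> polys_in V \<Longrightarrow> v \<notin> V \<Longrightarrow> pdiff v p = 0"
  by (induction p rule: polys_in_induct) (auto simp: pdiff_var pdiff_add pdiff_mult)

lemma polys_in_pdiff: "p \<in> polys_in V \<Longrightarrow> pdiff v p \<in> polys_in V"
  by (induction p rule: polys_in_induct) (auto simp: pdiff_var pdiff_add pdiff_mult intro: polys_in_closed)

section \<open>Homogeneous components\<close>

lemma wsum_superset:
  assumes "finite A" "Poly_Mapping.keys m \<subseteq> A"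
  shows "(\<Sum>v\<in>Poly_Mapping.keys m. Poly_Mapping.lookup m v) = (\<Sum>v\<in>A. Poly_Mapping.lookup (m::monom) v)"
  by (rule sum.mono_neutral_left) (use assms in \<open>auto simp: in_keys_iff\<close>)

lemma monom_degree_add: "monom_degree (a + b) = monom_degree a + monom_degree b"
proof -
  let ?A = "Poly_Mapping.keys a \<union> Poly_Mapping.keys b"
  show ?thesis
    unfolding monom_degree_def
    by (subst (1 2 3) wsum_superset[of ?A]) (auto simp: keys_add_nat lookup_add sum.distrib)
qed

lemma monom_degree_single [simp]: "monom_degree (Poly_Mapping.single v k) = k"
  by (simp add: monom_degree_def)

lemma monom_degree_0 [simp]: "monom_degree 0 = 0"
  by (simp add: monom_degree_def)

lemma monom_degree_eq_0 [simp]: "monom_degree m = 0 \<longleftrightarrow> m = 0"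
  by (auto simp: monom_degree_def in_keys_iff intro: poly_mapping_eqI)

lemma monom_split:
  assumes "Poly_Mapping.lookup (m::monom) v \<noteq> 0"
  shows "m = Poly_Mapping.single v 1 + (m - Poly_Mapping.single v 1)"
  by (rule poly_mapping_eqI) (use assms in \<open>auto simp: lookup_add lookup_minus lookup_single when_def\<close>)

text \<open>
  The homogeneous component of degree \<open>d\<close>.
\<close>
definition hc :: "nat \<Rightarrow> cpoly \<Rightarrow> cpoly" where
  "hc d p = (\<Sum>m\<in>Poly_Mapping.keys p. 
     Poly_Mapping.single m (if monom_degree m = d then Poly_Mapping.lookup p m else 0))"

lemma lookup_hc: "Poly_Mapping.lookup (hc d p) m = (if monom_degree m = d then Poly_Mapping.lookup p m else 0)"
  by (auto simp: hc_def lookup_sum lookup_single when_def in_keys_iff)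

lemma hc_add: "hc d (p + q) = hc d p + hc d q"
  by (rule poly_mapping_eqI) (simp add: lookup_hc lookup_add)

lemma hc_0 [simp]: "hc d 0 = 0"
  by (simp add: hc_def)

lemma hc_sum: "hc d (sum f A) = (\<Sum>i\<in>A. hc d (f i))"
  by (induction A rule: infinite_finite_induct) (simp_all add: hc_add)

lemma hc_diff: "hc d (p - q) = hc d p - hc d q"
  by (rule poly_mapping_eqI) (simp add: lookup_hc lookup_minus)

lemma hc_single: "hc d (Poly_Mapping.single m c) = (if monom_degree m = d then Poly_Mapping.single m c else 0)"
  by (rule poly_mapping_eqI) (auto simp: lookup_hc lookup_single when_def)

lemma hc_cst: "hc d (cst c) = (if d = 0 then cst c else 0)"
  by (auto simp: cst_def hc_single)

lemma hc_var: "hc d (var v) = (if d = 1 then var v else 0)"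
  by (auto simp: var_def hc_single)

lemma hc_mult: "hc d (p * q) = (\<Sum>i\<le>d. hc i p * hc (d - i) q)"
proof (induction p rule: additive_induct)
  case (single m c)
  show ?case
  proof (induction q rule: additive_induct)
    case (single m' c')
    have "(\<Sum>i\<le>d. hc i (Poly_Mapping.single m c) * hc (d - i) (Poly_Mapping.single m' c')) =
      (\<Sum>i\<le>d. if i = monom_degree m then
         (if monom_degree m' = d - i then Poly_Mapping.single (m + m') (c * c') else 0) else 0)"
      by (rule sum.cong) (auto simp: hc_single mult_single)
    also have "\<dots> = hc d (Poly_Mapping.single (m + m') (c * c'))"
      by (auto simp: hc_single monom_degree_add)
    finally show ?case by (simp add: mult_single)
  qed (simp add: ring_distribs hc_add sum.distrib)
qed (simp add: ring_distribs hc_add sum.distrib)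

lemma hc_cst_mult: "hc d (cst c * p) = cst c * hc d p"
  by (induction p rule: additive_induct) (simp_all add: cst_mult_single hc_single hc_add ring_distribs)

lemma hc_pdiff: "hc d (pdiff v p) = pdiff v (hc (Suc d) p)"
proof (induction p rule: additive_induct)
  case (single m c)
  show ?case
  proof (cases "Poly_Mapping.lookup m v = 0")
    case False
    have "monom_degree m = Suc (monom_degree (m - Poly_Mapping.single v 1))"
      by (subst monom_split[OF False]) (simp add: monom_degree_add)
    then show ?thesis by (auto simp: pdiff_single hc_single)
  qed (auto simp: pdiff_single hc_single)
qed (simp add: pdiff_add hc_add)

lemma homogeneous_hc: "homogeneous d (hc d p)"
  by (auto simp: homogeneous_def in_keys_iff lookup_hc split: if_splits)

lemma hc_homogeneous: "homogeneous d p \<Longrightarrow> hc e p = (if e = d then p else 0)"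
  by (rule poly_mapping_eqI) (auto simp: homogeneous_def lookup_hc in_keys_iff)

lemma hc_eqI: "(\<And>d. hc d p = hc d q) \<Longrightarrow> p = q"
  by (rule poly_mapping_eqI) (metis lookup_hc)

lemma hc_bound: "\<exists>N. \<forall>d\<ge>N. hc d p = 0"
proof -
  have "finite (monom_degree ` Poly_Mapping.keys p)" by simp
  then obtain N where "\<forall>x\<in>monom_degree ` Poly_Mapping.keys p. x < N"
    using finite_nat_set_iff_bounded by blast
  then have "hc d p = 0" if "d \<ge> N" for d
    by (intro poly_mapping_eqI) (use that in \<open>force simp: lookup_hc in_keys_iff\<close>)
  then show ?thesis by blast
qed

lemma sum_hc:
  assumes "\<forall>d\<ge>N. hc d p = 0"
  shows "(\<Sum>d<N. hc d p) = p"
proof (rule poly_mapping_eqI)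
  fix m
  have "Poly_Mapping.lookup p m = 0" if "monom_degree m \<ge> N"
    using assms that lookup_hc[of "monom_degree m" p m] by simp
  then show "Poly_Mapping.lookup (\<Sum>d<N. hc d p) m = Poly_Mapping.lookup p m"
    by (auto simp: lookup_sum lookup_hc not_less)
qed

lemma polys_in_hc: "p \<in> polys_in V \<Longrightarrow> hc d p \<in> polys_in V"
  by (auto simp: polys_in_def in_keys_iff lookup_hc split: if_splits)

lemma homogeneous_add: "homogeneous d p \<Longrightarrow> homogeneous d q \<Longrightarrow> homogeneous d (p + q)"
  using keys_add[of p q] by (auto simp: homogeneous_def)

lemma homogeneous_0 [simp]: "homogeneous d 0"
  by (simp add: homogeneous_def)

lemma homogeneous_sum: "(\<And>i. i \<in> A \<Longrightarrow> homogeneous d (f i)) \<Longrightarrow> homogeneous d (sum f A)"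
  by (induction A rule: infinite_finite_induct) (auto intro: homogeneous_add)

lemma homogeneous_uminus: "homogeneous d p \<Longrightarrow> homogeneous d (- p)"
  by (auto simp: homogeneous_def in_keys_iff)

lemma homogeneous_mult: "homogeneous d p \<Longrightarrow> homogeneous e q \<Longrightarrow> homogeneous (d + e) (p * q)"
  using keys_mult[of p q] by (fastforce simp: homogeneous_def monom_degree_add)

lemma homogeneous_var: "homogeneous 1 (var v)"
  by (simp add: homogeneous_def var_def)

lemma homogeneous_cst: "homogeneous 0 (cst c)"
  by (simp add: homogeneous_def cst_def)

text \<open>
  In characteristic zero, a polynomial all of whose partial derivatives vanish is constant.
\<close>
lemma pdiff_all_zero:
  assumes "p \<in> polys_in V" "\<And>v. v \<in> V \<Longrightarrow> pdiff v p = 0"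
  shows "p = hc 0 p"
proof (rule poly_mapping_eqI)
  fix m
  show "Poly_Mapping.lookup p m = Poly_Mapping.lookup (hc 0 p) m"
  proof (rule ccontr)
    assume "\<not> ?thesis"
    then have nz: "m \<in> Poly_Mapping.keys p" "m \<noteq> 0" by (auto simp: lookup_hc in_keys_iff split: if_splits)
    then obtain v where v: "Poly_Mapping.lookup m v \<noteq> 0"
      by (metis poly_mapping_eqI lookup_zero)
    then have "v \<in> V" using nz assms(1) by (fastforce simp: polys_in_def simp flip: lookup_not_eq_zero_eq_in_keys)
    have "Poly_Mapping.lookup (pdiff v p) (m - Poly_Mapping.single v 1) =
        of_nat (Poly_Mapping.lookup m v) * Poly_Mapping.lookup p m"
    proof (induction p rule: additive_induct)
      case (single k c)
      show ?case
      proof (cases "Poly_Mapping.lookup k v = 0")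
        case True
        then show ?thesis using v by (auto simp: pdiff_single lookup_single when_def)
      next
        case False
        have "k - Poly_Mapping.single v 1 = m - Poly_Mapping.single v 1 \<longleftrightarrow> k = m"
          using monom_split[OF False] monom_split[OF v] by metis
        then show ?thesis by (auto simp: pdiff_single lookup_single when_def)
      qed
    qed (simp add: pdiff_add lookup_add ring_distribs)
    then show False
      using assms(2)[OF \<open>v \<in> V\<close>] v nz by (auto simp: in_keys_iff)
  qed
qed

section \<open>Replacing \<open>\<xi>\<close> by differentiation\<close>

text \<open>
  The monomial \<open>\<xi>\<^sup>\<alpha> z\<^sup>\<beta>\<close> is sent to \<open>\<partial>\<^sup>\<alpha> z\<^sup>\<beta>\<close>, which is the product of the falling factorials
  \<open>\<beta>\<^sub>i (\<beta>\<^sub>i - 1) \<dots> (\<beta>\<^sub>i - \<alpha>\<^sub>i + 1)\<close>, given by \<open>contract_coeff\<close>, times \<open>z\<^sup>\<beta>\<^sup>-\<^sup>\<alpha>\<close>, given by \<open>contract\<close>.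
  Subtraction is truncated in both; if \<open>\<alpha>\<^sub>i > \<beta>\<^sub>i\<close> for some \<open>i\<close>, the coefficient contains the factor
  \<open>\<beta>\<^sub>i - \<beta>\<^sub>i = 0\<close>.
\<close>
definition contract :: "monom \<Rightarrow> monom" where
  "contract m = Abs_poly_mapping (\<lambda>v. case v of Xi i \<Rightarrow> 0
     | Zv i \<Rightarrow> Poly_Mapping.lookup m (Zv i) - Poly_Mapping.lookup m (Xi i))"

definition contract_coeff :: "monom \<Rightarrow> nat" where
  "contract_coeff m = (\<Prod>i | Xi i \<in> Poly_Mapping.keys m.
     \<Prod>k<Poly_Mapping.lookup m (Xi i). Poly_Mapping.lookup m (Zv i) - k)"

lemma lookup_contract: "Poly_Mapping.lookup (contract m) v = (case v of Xi i \<Rightarrow> 0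
     | Zv i \<Rightarrow> Poly_Mapping.lookup m (Zv i) - Poly_Mapping.lookup m (Xi i))"
proof -
  have "finite {v. (case v of Xi i \<Rightarrow> 0
     | Zv i \<Rightarrow> Poly_Mapping.lookup m (Zv i) - Poly_Mapping.lookup m (Xi i)) \<noteq> 0}"
  proof (rule finite_subset[of _ "Poly_Mapping.keys m"], rule subsetI)
    fix v assume "v \<in> {v. (case v of Xi i \<Rightarrow> 0
     | Zv i \<Rightarrow> Poly_Mapping.lookup m (Zv i) - Poly_Mapping.lookup m (Xi i)) \<noteq> 0}"
    then show "v \<in> Poly_Mapping.keys m" by (cases v) (auto simp: in_keys_iff)
  qed simp
  then show ?thesis by (simp add: contract_def)
qed

lemma finite_Xi_keys: "finite {i. Xi i \<in> Poly_Mapping.keys m}"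
  by (rule finite_subset[of _ "(\<lambda>v. case v of Xi i \<Rightarrow> i | Zv i \<Rightarrow> i) ` Poly_Mapping.keys m"])
    (force intro: rev_image_eqI)+

lemma contract_coeff_superset:
  assumes "finite A" "{i. Xi i \<in> Poly_Mapping.keys m} \<subseteq> A"
  shows "contract_coeff m = (\<Prod>i\<in>A. \<Prod>k<Poly_Mapping.lookup m (Xi i). Poly_Mapping.lookup m (Zv i) - k)"
  unfolding contract_coeff_def
  by (rule prod.mono_neutral_left) (use assms in \<open>auto simp: in_keys_iff\<close>)

text \<open>
  The linear map \<open>\<E>\<close> with \<open>\<E>(\<xi>\<^sup>\<alpha> h(z)) = \<partial>\<^sup>\<alpha> h\<close>.
\<close>
definition contr :: "cpoly \<Rightarrow> cpoly" where
  "contr p = (\<Sum>m\<in>Poly_Mapping.keys p.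
     Poly_Mapping.single (contract m) (of_nat (contract_coeff m) * Poly_Mapping.lookup p m))"

lemma contr_single: "contr (Poly_Mapping.single m c) =
    Poly_Mapping.single (contract m) (of_nat (contract_coeff m) * c)"
  by (cases "c = 0") (simp_all add: contr_def)

lemma contr_add: "contr (p + q) = contr p + contr q"
  unfolding contr_def
  by (rule setsum_keys_plus_distrib[where f = "\<lambda>m c. Poly_Mapping.single (contract m)
       (of_nat (contract_coeff m) * c)"])
    (simp_all add: single_add ring_distribs)

lemma contr_0 [simp]: "contr 0 = 0"
  by (simp add: contr_def)

lemma contr_sum: "contr (sum f A) = (\<Sum>i\<in>A. contr (f i))"
  by (induction A rule: infinite_finite_induct) (simp_all add: contr_add)

lemma contr_diff: "contr (p - q) = contr p - contr q"
proof -
  have "contr p = contr (p - q) + contr q" by (simp flip: contr_add)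
  then show ?thesis by simp
qed

lemma contr_Xi: "contr (var (Xi i) * p) = pdiff (Zv i) (contr p)"
proof (induction p rule: additive_induct)
  case (single m c)
  let ?m = "Poly_Mapping.single (Xi i) 1 + m"
  let ?A = "insert i {i. Xi i \<in> Poly_Mapping.keys m}"
  have A: "finite ?A" by (simp add: finite_Xi_keys)
  have 1: "contract ?m = contract m - Poly_Mapping.single (Zv i) 1"
    by (rule poly_mapping_eqI)
      (auto simp: lookup_contract lookup_minus lookup_add lookup_single when_def split: pvar.splits)
  have "contract_coeff ?m =
      (\<Prod>j\<in>?A. \<Prod>k<Poly_Mapping.lookup ?m (Xi j). Poly_Mapping.lookup ?m (Zv j) - k)"
    by (rule contract_coeff_superset[OF A]) (auto simp: keys_add_nat)
  also have "\<dots> = (\<Prod>j\<in>?A. (\<Prod>k<Poly_Mapping.lookup m (Xi j). Poly_Mapping.lookup m (Zv j) - k) *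
      (if j = i then Poly_Mapping.lookup (contract m) (Zv i) else 1))"
    by (rule prod.cong) (auto simp: lookup_add lookup_single when_def lookup_contract)
  also have "\<dots> = contract_coeff m * Poly_Mapping.lookup (contract m) (Zv i)"
    using A by (simp add: prod.distrib contract_coeff_superset[OF A subset_insertI] del: prod.insert)
  finally show ?case
    unfolding var_def mult_single contr_single pdiff_single by (simp add: 1 mult_ac del: One_nat_def)
qed (simp add: contr_add pdiff_add ring_distribs)

lemma falling_shift: "(\<Prod>k<a. b - 1 - k) * b = (\<Prod>k<a. b - k) * (b - a :: nat)"
proof (induction a)
  case (Suc a)
  have "(\<Prod>k<Suc a. b - 1 - k) * b = (\<Prod>k<a. b - 1 - k) * b * (b - 1 - a)" by simp
  then show ?case unfolding Suc.IH by simp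
qed simp

lemma contr_pdiff: "contr (pdiff (Zv i) p) = pdiff (Zv i) (contr p)"
proof (induction p rule: additive_induct)
  case (single m c)
  let ?m = "m - Poly_Mapping.single (Zv i) 1"
  let ?A = "insert i {i. Xi i \<in> Poly_Mapping.keys m}"
  have A: "finite ?A" by (simp add: finite_Xi_keys)
  have 1: "contract ?m = contract m - Poly_Mapping.single (Zv i) 1"
    by (rule poly_mapping_eqI)
      (auto simp: lookup_contract lookup_minus lookup_add lookup_single when_def split: pvar.splits)
  have "contract_coeff ?m * Poly_Mapping.lookup m (Zv i) =
      (\<Prod>j\<in>?A. \<Prod>k<Poly_Mapping.lookup ?m (Xi j). Poly_Mapping.lookup ?m (Zv j) - k) *
      (\<Prod>j\<in>?A. if j = i then Poly_Mapping.lookup m (Zv i) else 1)"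
    using A by (subst contract_coeff_superset[OF A]) (auto simp: in_keys_iff lookup_minus)
  also have "\<dots> = (\<Prod>j\<in>?A. (\<Prod>k<Poly_Mapping.lookup m (Xi j). Poly_Mapping.lookup m (Zv j) - k) *
      (if j = i then Poly_Mapping.lookup (contract m) (Zv i) else 1))"
    unfolding prod.distrib[symmetric]
    by (rule prod.cong) (use falling_shift in \<open>auto simp: lookup_minus lookup_single when_def lookup_contract\<close>)
  also have "\<dots> = contract_coeff m * Poly_Mapping.lookup (contract m) (Zv i)"
    using A by (simp add: prod.distrib contract_coeff_superset[OF A subset_insertI] del: prod.insert)
  finally have "of_nat (contract_coeff ?m) * of_nat (Poly_Mapping.lookup m (Zv i)) =
     (of_nat (contract_coeff m) * of_nat (Poly_Mapping.lookup (contract m) (Zv i)) :: complex)"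
    by (metis of_nat_mult)
  then have "of_nat (contract_coeff ?m) * (of_nat (Poly_Mapping.lookup m (Zv i)) * c) =
     of_nat (Poly_Mapping.lookup (contract m) (Zv i)) * (of_nat (contract_coeff m) * c)"
    by (simp only: mult.assoc[symmetric]) (simp only: mult.commute)
  then show ?case
    unfolding contr_single pdiff_single 1 by (simp only:)
qed (simp add: contr_add pdiff_add)

lemma contr_id:
  assumes "p \<in> polys_z n"
  shows "contr p = p"
proof -
  have "contract m = m \<and> contract_coeff m = 1" if "m \<in> Poly_Mapping.keys p" for m
  proof -
    have *: "Poly_Mapping.lookup m (Xi i) = 0" for i
      using assms that by (force simp: polys_z_def polys_in_def in_keys_iff)
    then have "contract m = m"
      by (intro poly_mapping_eqI) (auto simp: lookup_contract split: pvar.splits)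
    then show ?thesis using * by (simp add: contract_coeff_def in_keys_iff)
  qed
  then show ?thesis
    unfolding contr_def by (subst (3) poly_mapping_expand) (auto intro!: sum.cong)
qed

lemma contr_polys_z:
  assumes "p \<in> polys_xi_z n"
  shows "contr p \<in> polys_z n"
  unfolding contr_def polys_z_def
proof (rule polys_in_sum)
  fix m assume m: "m \<in> Poly_Mapping.keys p"
  have "Poly_Mapping.keys (contract m) \<subseteq> Zv ` {..<n}"
  proof
    fix v assume v: "v \<in> Poly_Mapping.keys (contract m)"
    then obtain i where "v = Zv i" "v \<in> Poly_Mapping.keys m"
      by (cases v) (auto simp: in_keys_iff lookup_contract)
    moreover have "Poly_Mapping.keys m \<subseteq> Xi ` {..<n} \<union> Zv ` {..<n}"
      using assms m by (auto simp: polys_xi_z_def polys_in_def)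
    ultimately show "v \<in> Zv ` {..<n}" by blast
  qed
  then show "Poly_Mapping.single (contract m) (of_nat (contract_coeff m) * Poly_Mapping.lookup p m)
      \<in> polys_in (Zv ` {..<n})"
    by (auto simp: polys_in_def in_keys_iff lookup_single when_def split: if_splits)
qed

section \<open>The image of \<open>\<Theta>\<close> as a kernel\<close>

lemma Theta_add: "Theta i (p + q) = Theta i p + Theta i q"
  by (simp add: Theta_def pdiff_add ring_distribs)

lemma Theta_0 [simp]: "Theta i 0 = 0"
  by (simp add: Theta_def)

lemma contr_Theta: "contr (Theta i p) = 0"
  by (simp add: Theta_def contr_diff contr_Xi contr_pdiff)

lemma Im_Theta_0: "0 \<in> Im_Theta n"
  unfolding Im_Theta_def by (auto intro!: exI[of _ "\<lambda>_. 0"] simp: polys_xi_z_def)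

lemma Im_Theta_add:
  assumes "p \<in> Im_Theta n" "q \<in> Im_Theta n"
  shows "p + q \<in> Im_Theta n"
proof -
  from assms obtain r s where "p = (\<Sum>i<n. Theta i (r i))" "\<forall>i<n. r i \<in> polys_xi_z n"
      "q = (\<Sum>i<n. Theta i (s i))" "\<forall>i<n. s i \<in> polys_xi_z n"
    by (auto simp: Im_Theta_def)
  then show ?thesis unfolding Im_Theta_def
    by (auto intro!: exI[of _ "\<lambda>i. r i + s i"] polys_in_add simp: Theta_add sum.distrib polys_xi_z_def)
qed

lemma Im_Theta_sum: "(\<And>i. i \<in> A \<Longrightarrow> f i \<in> Im_Theta n) \<Longrightarrow> sum f A \<in> Im_Theta n"
  by (induction A rule: infinite_finite_induct) (auto intro: Im_Theta_add Im_Theta_0)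

lemma Theta_in_Im_Theta: "i < n \<Longrightarrow> p \<in> polys_xi_z n \<Longrightarrow> Theta i p \<in> Im_Theta n"
  unfolding Im_Theta_def
  by (auto intro!: exI[of _ "\<lambda>j. if j = i then p else 0"] simp: polys_xi_z_def if_distrib[of "Theta _"] cong: if_cong)

lemma Im_Theta_pdiff:
  assumes "p \<in> Im_Theta n"
  shows "pdiff (Zv k) p \<in> Im_Theta n"
proof -
  from assms obtain r where r: "p = (\<Sum>i<n. Theta i (r i))" "\<forall>i<n. r i \<in> polys_xi_z n"
    by (auto simp: Im_Theta_def)
  have "pdiff (Zv k) (Theta i q) = Theta i (pdiff (Zv k) q)" for i q
    by (simp add: Theta_def pdiff_diff pdiff_mult pdiff_var pdiff_commute)
  with r show ?thesis unfolding Im_Theta_def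
    by (auto intro!: exI[of _ "\<lambda>i. pdiff (Zv k) (r i)"] polys_in_pdiff simp: pdiff_sum polys_xi_z_def)
qed

text \<open>
  Modulo \<open>Im \<Theta>\<close> a factor \<open>\<xi>\<^sub>i\<close> may be replaced by \<open>\<partial>\<^sub>i\<close>, because \<open>\<xi>\<^sub>i q = \<Theta>\<^sub>i q + \<partial>\<^sub>i q\<close>; this
  is repeated until no \<open>\<xi>\<close> is left, using that \<open>Im \<Theta>\<close> is stable under \<open>\<partial>\<^sub>i\<close>.
\<close>
lemma diff_contr_monom_in_Im_Theta:
  assumes "Poly_Mapping.keys m \<subseteq> Xi ` {..<n} \<union> Zv ` {..<n}"
  shows "Poly_Mapping.single m c - contr (Poly_Mapping.single m c) \<in> Im_Theta n"
  using assms
proof (induction "monom_degree m" arbitrary: m rule: less_induct)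
  case less
  show ?case
  proof (cases "\<exists>i. Poly_Mapping.lookup m (Xi i) \<noteq> 0")
    case False
    then have "Xi i \<notin> Poly_Mapping.keys m" for i by (simp add: in_keys_iff)
    then have "Poly_Mapping.keys m \<subseteq> Zv ` {..<n}" using less.prems by blast
    then have "Poly_Mapping.single m c \<in> polys_z n" by (simp add: polys_z_def polys_in_def)
    then show ?thesis by (simp add: contr_id Im_Theta_0)
  next
    case True
    then obtain i where i: "Poly_Mapping.lookup m (Xi i) \<noteq> 0" by blast
    then have "i < n" using less.prems by (auto simp: in_keys_iff subset_iff)
    define k where "k = m - Poly_Mapping.single (Xi i) 1"
    have m: "m = Poly_Mapping.single (Xi i) 1 + k" unfolding k_def by (rule monom_split[OF i])
    have keys: "Poly_Mapping.keys k \<subseteq> Xi ` {..<n} \<union> Zv ` {..<n}"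
      using less.prems unfolding m keys_add_nat by simp
    let ?q = "Poly_Mapping.single k c"
    have q: "?q \<in> polys_xi_z n"
      using keys by (auto simp: polys_xi_z_def polys_in_def)
    have IH: "?q - contr ?q \<in> Im_Theta n"
      by (rule less.hyps[OF _ keys]) (simp add: m monom_degree_add)
    have mq: "Poly_Mapping.single m c = var (Xi i) * ?q"
      by (simp add: m var_def mult_single)
    have "Poly_Mapping.single m c - contr (Poly_Mapping.single m c) =
        Theta i ?q + pdiff (Zv i) (?q - contr ?q)"
      unfolding mq contr_Xi by (simp add: Theta_def pdiff_diff)
    then show ?thesis
      using Im_Theta_add[OF Theta_in_Im_Theta[OF \<open>i < n\<close> q] Im_Theta_pdiff[OF IH]] by simp
  qed
qed

lemma Im_Theta_iff:
  assumes p: "p \<in> polys_xi_z n"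
  shows "p \<in> Im_Theta n \<longleftrightarrow> contr p = 0"
proof
  assume "p \<in> Im_Theta n"
  then show "contr p = 0"
    by (auto simp: Im_Theta_def contr_sum contr_Theta)
next
  assume 0: "contr p = 0"
  let ?s = "\<lambda>m. Poly_Mapping.single m (Poly_Mapping.lookup p m)"
  have "(\<Sum>m\<in>Poly_Mapping.keys p. ?s m - contr (?s m)) \<in> Im_Theta n"
    using p by (intro Im_Theta_sum diff_contr_monom_in_Im_Theta) (auto simp: polys_xi_z_def polys_in_def)
  also have "(\<Sum>m\<in>Poly_Mapping.keys p. ?s m - contr (?s m)) = p - contr p"
    by (simp add: sum_subtractf contr_sum[symmetric] flip: poly_mapping_expand)
  finally show "p \<in> Im_Theta n" using 0 by simp
qed

section \<open>Polynomial maps as substitutions\<close>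

text \<open>
  Substitution of \<open>F i\<close> for \<open>z\<^sub>i\<close>, with \<open>\<xi>\<close> left alone. As \<open>F\<close> is defined on all indices, the number of
  variables is not part of the data, and a map in \<open>n\<close> variables with \<open>F i = z\<^sub>i\<close> for \<open>i \<ge> n\<close> is at the
  same time its extension by the identity to more variables. The composite of \<open>F\<close> after \<open>G\<close> has the
  components \<open>sub G (F i)\<close>.
\<close>
definition sub :: "(nat \<Rightarrow> cpoly) \<Rightarrow> cpoly \<Rightarrow> cpoly" where
  "sub F = psub cst (\<lambda>v. case v of Xi j \<Rightarrow> var (Xi j) | Zv j \<Rightarrow> F j)"

lemma comm_ring_hom_sub: "comm_ring_hom (sub F)"
  unfolding sub_def by (rule comm_ring_hom_psub[OF comm_ring_hom_cst])

lemma sub_simps [simp]: "sub F (cst c) = cst c" "sub F (var (Xi j)) = var (Xi j)" "sub F (var (Zv j)) = F j"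
  by (simp_all add: sub_def psub_cst[OF comm_ring_hom_cst] psub_var[OF comm_ring_hom_cst])

lemma sub_0 [simp]: "sub F 0 = 0" and sub_1 [simp]: "sub F 1 = 1"
  and sub_add: "sub F (p + q) = sub F p + sub F q"
  and sub_mult: "sub F (p * q) = sub F p * sub F q"
  and sub_diff: "sub F (p - q) = sub F p - sub F q"
  and sub_uminus: "sub F (- p) = - sub F p"
  and sub_sum: "sub F (sum g A) = (\<Sum>i\<in>A. sub F (g i))"
  and sub_power: "sub F (p ^ k) = sub F p ^ k"
proof -
  interpret comm_ring_hom "sub F" by (rule comm_ring_hom_sub)
  show "sub F 0 = 0" "sub F 1 = 1" "sub F (p + q) = sub F p + sub F q"
    "sub F (p * q) = sub F p * sub F q" "sub F (p - q) = sub F p - sub F q" "sub F (- p) = - sub F p"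
    "sub F (sum g A) = (\<Sum>i\<in>A. sub F (g i))" "sub F (p ^ k) = sub F p ^ k"
    by (simp_all add: hom_distribs)
qed

lemma polys_z_var [simp]: "var (Zv i) \<in> polys_z n \<longleftrightarrow> i < n"
  by (auto simp: polys_z_def)

lemma polys_z_simps [simp]: "cst c \<in> polys_z n" "0 \<in> polys_z n" "1 \<in> polys_z n"
  by (simp_all add: polys_z_def)

lemmas polys_z_closed = polys_in_closed[where V = "Zv ` {..<n}" for n, folded polys_z_def]

lemma polys_z_pdiff: "p \<in> polys_z n \<Longrightarrow> pdiff v p \<in> polys_z n"
  by (simp add: polys_z_def polys_in_pdiff)

lemma polys_z_hc: "p \<in> polys_z n \<Longrightarrow> hc d p \<in> polys_z n"
  by (simp add: polys_z_def polys_in_hc)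

lemma polys_z_mono: "n \<le> m \<Longrightarrow> p \<in> polys_z n \<Longrightarrow> p \<in> polys_z m"
  using polys_in_mono[of "Zv ` {..<n}" "Zv ` {..<m}"] by (force simp: polys_z_def)

lemma polys_z_xi_z: "p \<in> polys_z n \<Longrightarrow> p \<in> polys_xi_z n"
  using polys_in_mono[of "Zv ` {..<n}" "Xi ` {..<n} \<union> Zv ` {..<n}"] by (auto simp: polys_z_def polys_xi_z_def)

lemma polys_z_induct [consumes 1, case_names cst var add mult]:
  assumes "p \<in> polys_z n" "\<And>c. P (cst c)" "\<And>i. i < n \<Longrightarrow> P (var (Zv i))"
    "\<And>p q. p \<in> polys_z n \<Longrightarrow> q \<in> polys_z n \<Longrightarrow> P p \<Longrightarrow> P q \<Longrightarrow> P (p + q)"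
    "\<And>p q. p \<in> polys_z n \<Longrightarrow> q \<in> polys_z n \<Longrightarrow> P p \<Longrightarrow> P q \<Longrightarrow> P (p * q)"
  shows "P p"
  using assms(1) unfolding polys_z_def
  by (induction p rule: polys_in_induct) (use assms(2-5) in \<open>auto simp: polys_z_def\<close>)

lemma polys_z_sub:
  assumes "p \<in> polys_z n" "\<And>i. i < n \<Longrightarrow> F i \<in> polys_z m"
  shows "sub F p \<in> polys_z m"
  using assms(1)
  by (induction p rule: polys_z_induct) (auto simp: assms sub_add sub_mult intro: polys_z_closed)

text \<open>
  \<open>G\<close> is a two-sided polynomial inverse of \<open>F\<close> in the variables \<open>z\<^sub>0, \<dots>, z\<^bsub>n-1\<^esub>\<close>, as an identity of
  polynomials.
\<close>
definition poly_inverse :: "nat \<Rightarrow> (nat \<Rightarrow> cpoly) \<Rightarrow> (nat \<Rightarrow> cpoly) \<Rightarrow> bool" where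
  "poly_inverse n F G \<longleftrightarrow>
     (\<forall>i<n. G i \<in> polys_z n \<and> sub F (G i) = var (Zv i) \<and> sub G (F i) = var (Zv i))"

section \<open>The formula of Jacobi and the identity of Piola\<close>

lemma pdiff_prod:
  "finite S \<Longrightarrow> pdiff v (\<Prod>i\<in>S. f i) = (\<Sum>i\<in>S. \<Prod>k\<in>S. if k = i then pdiff v (f k) else f k)"
proof (induction S rule: finite_induct)
  case (insert x S)
  have "(\<Prod>k\<in>S. if k = x then pdiff v (f k) else f k) = prod f S"
    by (rule prod.cong) (use insert in auto)
  moreover have "(\<Sum>i\<in>S. (if x = i then pdiff v (f x) else f x) * (\<Prod>k\<in>S. if k = i then pdiff v (f k) else f k)) =
     (\<Sum>i\<in>S. f x * (\<Prod>k\<in>S. if k = i then pdiff v (f k) else f k))"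
    by (rule sum.cong) (use insert in auto)
  ultimately show ?case
    using insert by (simp add: pdiff_mult sum_distrib_left)
qed simp

lemma pdiff_signof: "pdiff v (signof p * x) = signof p * pdiff v x"
  by (simp add: sign_def pdiff_uminus)

lemma polys_in_det:
  assumes A: "A \<in> carrier_mat n n" and "\<And>i j. i < n \<Longrightarrow> j < n \<Longrightarrow> A $$ (i, j) \<in> polys_in V"
  shows "det A \<in> polys_in V"
proof -
  have "signof p * (\<Prod>i = 0..<n. A $$ (i, p i)) \<in> polys_in V" if "p permutes {0..<n}" for p
  proof -
    have "(\<Prod>i = 0..<n. A $$ (i, p i)) \<in> polys_in V"
      using permutes_in_image[OF that] by (intro polys_in_prod assms) auto
    then show ?thesis by (auto simp: sign_def intro: polys_in_uminus)
  qed
  then show ?thesis unfolding det_def'[OF A] by (auto intro: polys_in_sum)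
qed

lemma polys_in_adj_mat:
  assumes A: "A \<in> carrier_mat n n" and "\<And>i j. i < n \<Longrightarrow> j < n \<Longrightarrow> A $$ (i, j) \<in> polys_in V"
    and "i < n" "j < n"
  shows "adj_mat A $$ (i, j) \<in> polys_in V"
proof -
  have "det (mat_delete A j i) \<in> polys_in V"
    by (rule polys_in_det[of _ "n - 1"]) (use assms in \<open>auto simp: mat_delete_def\<close>)
  moreover have "(- 1) ^ (j + i) \<in> polys_in V"
    by (intro polys_in_power polys_in_uminus) simp
  ultimately show ?thesis
    using assms by (auto simp: adj_mat_def cofactor_def intro: polys_in_mult)
qed

text \<open>
  The derivative of a determinant is the sum over \<open>i\<close> of the determinants with row \<open>i\<close> differentiated,
  each of which is expanded along that row.
\<close>
lemma jacobi_formula: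
  assumes A: "A \<in> carrier_mat n n"
  shows "pdiff v (det A) = (\<Sum>i<n. \<Sum>j<n. pdiff v (A $$ (i, j)) * adj_mat A $$ (j, i))"
proof -
  define B where "B i = mat n n (\<lambda>(k, j). if k = i then pdiff v (A $$ (k, j)) else A $$ (k, j))" for i
  have B: "B i \<in> carrier_mat n n" for i by (simp add: B_def)
  have "pdiff v (det A) = (\<Sum>p | p permutes {0..<n}. signof p *
      (\<Sum>i<n. \<Prod>k = 0..<n. if k = i then pdiff v (A $$ (k, p k)) else A $$ (k, p k)))"
    unfolding det_def'[OF A] pdiff_sum
    by (simp add: pdiff_signof pdiff_prod lessThan_atLeast0)
  also have "\<dots> = (\<Sum>i<n. \<Sum>p | p permutes {0..<n}. signof p *
      (\<Prod>k = 0..<n. if k = i then pdiff v (A $$ (k, p k)) else A $$ (k, p k)))"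
    by (subst sum.swap) (simp add: sum_distrib_left)
  also have "\<dots> = (\<Sum>i<n. det (B i))"
  proof (rule sum.cong)
    fix i assume "i \<in> {..<n}"
    have "B i $$ (k, p k) = (if k = i then pdiff v (A $$ (k, p k)) else A $$ (k, p k))"
      if "p permutes {0..<n}" "k < n" for p k
      using that permutes_in_image[OF that(1), of k] by (simp add: B_def)
    then show "(\<Sum>p | p permutes {0..<n}. signof p *
      (\<Prod>k = 0..<n. if k = i then pdiff v (A $$ (k, p k)) else A $$ (k, p k))) = det (B i)"
      unfolding det_def'[OF B] by (auto intro!: sum.cong prod.cong)
  qed simp
  also have "\<dots> = (\<Sum>i<n. \<Sum>j<n. pdiff v (A $$ (i, j)) * adj_mat A $$ (j, i))"
  proof (rule sum.cong)
    fix i assume i: "i \<in> {..<n}"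
    have "mat_delete (B i) i j = mat_delete A i j" for j
      using A i by (intro eq_matI) (auto simp: mat_delete_def B_def)
    then show "det (B i) = (\<Sum>j<n. pdiff v (A $$ (i, j)) * adj_mat A $$ (j, i))"
      using i A by (subst laplace_expansion_row[OF B]) (auto simp: B_def adj_mat_def cofactor_def intro!: sum.cong)
  qed simp
  finally show ?thesis .
qed

text \<open>
  The Jacobian matrix.
\<close>
definition jac_mat :: "nat \<Rightarrow> (nat \<Rightarrow> cpoly) \<Rightarrow> cpoly mat" where
  "jac_mat n F = mat n n (\<lambda>(i, j). pdiff (Zv j) (F i))"

lemma jacobian_det_eq: "jacobian_det n F = det (jac_mat n F)"
  by (simp add: jacobian_det_def jac_mat_def)

lemma jac_mat_carrier [simp]: "jac_mat n F \<in> carrier_mat n n"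
  by (simp add: jac_mat_def)

lemma jac_mat_dim [simp]: "dim_row (jac_mat n F) = n" "dim_col (jac_mat n F) = n"
  by (simp_all add: jac_mat_def)

lemma jac_mat_index [simp]: "i < n \<Longrightarrow> j < n \<Longrightarrow> jac_mat n F $$ (i, j) = pdiff (Zv j) (F i)"
  by (simp add: jac_mat_def)

lemma adj_jac_mat_right:
  assumes "i < n" "k < n"
  shows "(\<Sum>a<n. pdiff (Zv a) (F i) * adj_mat (jac_mat n F) $$ (a, k)) = (if i = k then jacobian_det n F else 0)"
proof -
  have "(jac_mat n F * adj_mat (jac_mat n F)) $$ (i, k) = (if i = k then jacobian_det n F else 0)"
    using assms by (simp add: adj_mat(2)[of _ n] jacobian_det_eq)
  moreover have "(jac_mat n F * adj_mat (jac_mat n F)) $$ (i, k) =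
      (\<Sum>a<n. pdiff (Zv a) (F i) * adj_mat (jac_mat n F) $$ (a, k))"
    using assms adj_mat(1)[of "jac_mat n F" n]
    by (auto simp: scalar_prod_def lessThan_atLeast0 dest!: carrier_matD intro!: sum.cong)
  ultimately show ?thesis by simp
qed

lemma adj_jac_mat_left:
  assumes "i < n" "k < n"
  shows "(\<Sum>a<n. adj_mat (jac_mat n F) $$ (i, a) * pdiff (Zv k) (F a)) = (if i = k then jacobian_det n F else 0)"
proof -
  have "(adj_mat (jac_mat n F) * jac_mat n F) $$ (i, k) = (if i = k then jacobian_det n F else 0)"
    using assms by (simp add: adj_mat(3)[of _ n] jacobian_det_eq)
  moreover have "(adj_mat (jac_mat n F) * jac_mat n F) $$ (i, k) =
      (\<Sum>a<n. adj_mat (jac_mat n F) $$ (i, a) * pdiff (Zv k) (F a))"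
    using assms adj_mat(1)[of "jac_mat n F" n]
    by (auto simp: scalar_prod_def lessThan_atLeast0 dest!: carrier_matD intro!: sum.cong)
  ultimately show ?thesis by simp
qed

text \<open>
  The columns of the adjugate \<open>N\<close> of a Jacobian matrix \<open>M\<close> are divergence free. Differentiating
  \<open>M N = J\<close> and multiplying by \<open>N\<close> from the left gives
  \<open>J \<Sum>\<^sub>j \<partial>\<^sub>j N\<^sub>j\<^sub>k = \<Sum>\<^sub>j (\<partial>\<^sub>j J) N\<^sub>j\<^sub>k - \<Sum>\<^sub>j\<^sub>i\<^sub>a N\<^sub>j\<^sub>i (\<partial>\<^sub>j M\<^sub>i\<^sub>a) N\<^sub>a\<^sub>k\<close>. As \<open>\<partial>\<^sub>j M\<^sub>i\<^sub>a = \<partial>\<^sub>a M\<^sub>i\<^sub>j\<close>, the last sum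
  equals \<open>\<Sum>\<^sub>a (\<partial>\<^sub>a J) N\<^sub>a\<^sub>k\<close> by the formula of Jacobi, and \<open>J\<close> is cancelled.
\<close>
lemma piola:
  assumes J: "jacobian_det n F \<noteq> 0" and k: "k < n"
  shows "(\<Sum>j<n. pdiff (Zv j) (adj_mat (jac_mat n F) $$ (j, k))) = 0"
proof -
  define N where "N j k = adj_mat (jac_mat n F) $$ (j, k)" for j k
  define M where "M i j = pdiff (Zv j) (F i)" for i j
  define J where "J = jacobian_det n F"
  define d where "d j = pdiff (Zv j)" for j
  have R: "(\<Sum>a<n. M i a * N a k) = (if i = k then J else 0)" if "i < n" for i
    using adj_jac_mat_right[OF that k] by (simp add: N_def M_def J_def)
  have L: "(\<Sum>a<n. N i a * M a j) = (if i = j then J else 0)" if "i < n" "j < n" for i j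
    using adj_jac_mat_left[OF that] by (simp add: N_def M_def J_def)
  have jac: "d a J = (\<Sum>i<n. \<Sum>j<n. d a (M i j) * N j i)" for a
    using jacobi_formula[of "jac_mat n F" n "Zv a"] by (simp add: N_def M_def J_def d_def jacobian_det_eq)
  have sym: "d j (M i a) = d a (M i j)" for i j a
    by (simp add: d_def M_def pdiff_commute)
  have dR: "(\<Sum>a<n. d j (M i a) * N a k) + (\<Sum>a<n. M i a * d j (N a k)) = (if i = k then d j J else 0)"
    if "i < n" for i j
    using arg_cong[OF R[OF that], of "d j"]
    by (simp add: d_def pdiff_sum pdiff_mult sum.distrib split: if_splits)
  have key: "(\<Sum>i<n. \<Sum>a<n. N j i * d j (M i a) * N a k) + J * d j (N j k) = d j J * N j k" if j: "j < n" for j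
  proof -
    have "(\<Sum>i<n. N j i * ((\<Sum>a<n. d j (M i a) * N a k) + (\<Sum>a<n. M i a * d j (N a k)))) =
      (\<Sum>i<n. if i = k then N j i * d j J else 0)"
      by (rule sum.cong) (auto simp: dR)
    also have "\<dots> = d j J * N j k" using k by simp
    finally have "(\<Sum>i<n. \<Sum>a<n. N j i * d j (M i a) * N a k) +
        (\<Sum>i<n. \<Sum>a<n. N j i * M i a * d j (N a k)) = d j J * N j k"
      by (simp add: ring_distribs sum_distrib_left sum.distrib mult.assoc)
    moreover have "(\<Sum>i<n. \<Sum>a<n. N j i * M i a * d j (N a k)) = (\<Sum>a<n. (\<Sum>i<n. N j i * M i a) * d j (N a k))"
      by (subst sum.swap) (simp add: sum_distrib_right)
    moreover have "\<dots> = (\<Sum>a<n. if j = a then J * d j (N a k) else 0)"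
      by (rule sum.cong) (auto simp: L j)
    ultimately show ?thesis using j by simp
  qed
  have "(\<Sum>j<n. \<Sum>i<n. \<Sum>a<n. N j i * d j (M i a) * N a k) = (\<Sum>a<n. d a J * N a k)"
  proof -
    have "(\<Sum>j<n. \<Sum>i<n. \<Sum>a<n. N j i * d j (M i a) * N a k) = (\<Sum>j<n. \<Sum>a<n. \<Sum>i<n. d a (M i j) * N j i * N a k)"
      by (subst (2) sum.swap) (simp add: sym mult.commute[of "N _ _" "d _ _"])
    also have "\<dots> = (\<Sum>a<n. \<Sum>i<n. \<Sum>j<n. d a (M i j) * N j i * N a k)"
      by (subst sum.swap) (rule sum.cong[OF refl], rule sum.swap)
    also have "\<dots> = (\<Sum>a<n. d a J * N a k)"
      by (simp add: jac sum_distrib_right)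
    finally show ?thesis .
  qed
  moreover have "(\<Sum>j<n. (\<Sum>i<n. \<Sum>a<n. N j i * d j (M i a) * N a k) + J * d j (N j k)) = (\<Sum>j<n. d j J * N j k)"
    by (rule sum.cong) (auto simp: key)
  ultimately have "J * (\<Sum>j<n. d j (N j k)) = 0"
    by (simp add: sum.distrib sum_distrib_left)
  then show ?thesis using J by (simp add: J_def d_def N_def)
qed

section \<open>Bihomogeneous polynomials\<close>

lemma cst_eq_0_iff: "cst c = 0 \<longleftrightarrow> c = 0"
  by (metis cst_def lookup_single_eq lookup_zero single_zero)

text \<open>
  In every monomial the degree in \<open>z\<close> exceeds the degree in \<open>\<xi>\<close> by exactly \<open>w\<close>. This is the grading for
  which \<open>\<E>\<close> has degree zero.
\<close>
definition bihom :: "nat \<Rightarrow> nat \<Rightarrow> cpoly \<Rightarrow> bool" where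
  "bihom n w p \<longleftrightarrow> p \<in> polys_xi_z n \<and> (\<forall>m\<in>Poly_Mapping.keys p.
     (\<Sum>i<n. Poly_Mapping.lookup m (Zv i)) = (\<Sum>i<n. Poly_Mapping.lookup m (Xi i)) + w)"

lemma bihom_mult: "bihom n w p \<Longrightarrow> bihom n w' q \<Longrightarrow> bihom n (w + w') (p * q)"
  using keys_mult[of p q]
  by (fastforce simp: bihom_def polys_xi_z_def lookup_add sum.distrib intro: polys_in_mult)

lemma bihom_add: "bihom n w p \<Longrightarrow> bihom n w q \<Longrightarrow> bihom n w (p + q)"
  using keys_add[of p q]
  by (auto simp: bihom_def polys_xi_z_def intro: polys_in_add)

lemma bihom_sum: "(\<And>i. i \<in> A \<Longrightarrow> bihom n w (f i)) \<Longrightarrow> bihom n w (sum f A)"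
  by (induction A rule: infinite_finite_induct) (auto intro: bihom_add simp: bihom_def[of _ _ 0] polys_xi_z_def)

lemma bihom_power: "bihom n w p \<Longrightarrow> bihom n (k * w) (p ^ k)"
  by (induction k) (auto intro: bihom_mult simp: bihom_def[of _ _ 1] polys_xi_z_def)

lemma monom_degree_z:
  assumes "Poly_Mapping.keys m \<subseteq> Zv ` {..<n}"
  shows "monom_degree m = (\<Sum>i<n. Poly_Mapping.lookup m (Zv i))"
  unfolding monom_degree_def
  by (subst wsum_superset[OF _ assms]) (simp_all add: sum.reindex inj_on_def)

lemma bihom_homogeneous:
  assumes "homogeneous d u" "u \<in> polys_z n"
  shows "bihom n d u"
  unfolding bihom_def
proof (intro conjI ballI)
  show "u \<in> polys_xi_z n" using assms by (simp add: polys_z_xi_z)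
  fix m assume m: "m \<in> Poly_Mapping.keys u"
  then have k: "Poly_Mapping.keys m \<subseteq> Zv ` {..<n}" using assms by (auto simp: polys_z_def polys_in_def)
  then have "Xi i \<notin> Poly_Mapping.keys m" for i by auto
  then have "Poly_Mapping.lookup m (Xi i) = 0" for i by (simp add: in_keys_iff)
  then show "(\<Sum>i<n. Poly_Mapping.lookup m (Zv i)) = (\<Sum>i<n. Poly_Mapping.lookup m (Xi i)) + d"
    using m assms monom_degree_z[OF k] by (simp add: homogeneous_def)
qed

lemma bihom_Xi_mult:
  assumes "bihom n (Suc w) p" "i < n"
  shows "bihom n w (var (Xi i) * p)"
  unfolding bihom_def
proof (intro conjI ballI)
  show "var (Xi i) * p \<in> polys_xi_z n"
    using assms by (auto simp: bihom_def polys_xi_z_def intro: polys_in_mult)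
  fix m assume "m \<in> Poly_Mapping.keys (var (Xi i) * p)"
  then obtain k where "m = Poly_Mapping.single (Xi i) 1 + k" "k \<in> Poly_Mapping.keys p"
    using keys_mult[of "var (Xi i)" p] by (auto simp: var_def)
  then show "(\<Sum>i<n. Poly_Mapping.lookup m (Zv i)) = (\<Sum>i<n. Poly_Mapping.lookup m (Xi i)) + w"
    using assms by (auto simp: bihom_def lookup_add lookup_single when_def sum.distrib)
qed

lemma homogeneous_contr:
  assumes "bihom n w p"
  shows "homogeneous w (contr p)"
  unfolding contr_def
proof (rule homogeneous_sum)
  fix m assume m: "m \<in> Poly_Mapping.keys p"
  then have k: "Poly_Mapping.keys m \<subseteq> Xi ` {..<n} \<union> Zv ` {..<n}"
    and w: "(\<Sum>i<n. Poly_Mapping.lookup m (Zv i)) = (\<Sum>i<n. Poly_Mapping.lookup m (Xi i)) + w"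
    using assms by (auto simp: bihom_def polys_xi_z_def polys_in_def)
  show "homogeneous w (Poly_Mapping.single (contract m) (of_nat (contract_coeff m) * Poly_Mapping.lookup p m))"
  proof (cases "contract_coeff m = 0")
    case False
    have le: "Poly_Mapping.lookup m (Xi i) \<le> Poly_Mapping.lookup m (Zv i)" for i
    proof (rule ccontr)
      assume "\<not> ?thesis"
      then have "(\<Prod>k<Poly_Mapping.lookup m (Xi i). Poly_Mapping.lookup m (Zv i) - k) = 0"
          and "Xi i \<in> Poly_Mapping.keys m"
        by (auto simp: in_keys_iff intro!: prod_zero bexI[of _ "Poly_Mapping.lookup m (Zv i)"])
      then have "contract_coeff m = 0"
        unfolding contract_coeff_def using finite_Xi_keys by (intro prod_zero) auto
      then show False using False by simp
    qed
    have "Poly_Mapping.keys (contract m) \<subseteq> Zv ` {..<n}"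
    proof
      fix v assume v: "v \<in> Poly_Mapping.keys (contract m)"
      then obtain i where "v = Zv i" "v \<in> Poly_Mapping.keys m"
        by (cases v) (auto simp: in_keys_iff lookup_contract)
      with k show "v \<in> Zv ` {..<n}" by blast
    qed
    from monom_degree_z[OF this] have "monom_degree (contract m) = w"
      using w le by (simp add: lookup_contract sum_subtractf_nat)
    then show ?thesis by (simp add: homogeneous_def)
  qed simp
qed

section \<open>The inversion formula for cubic homogeneous maps\<close>

text \<open>
  Throughout, \<open>F = z - H\<close> and \<open>f = \<Sum>\<^sub>i \<xi>\<^sub>i H\<^sub>i\<close> with \<open>H\<close> homogeneous of degree 3.
\<close>
locale cubic_map =
  fixes n :: nat and H :: "nat \<Rightarrow> cpoly"
  assumes H_in: "i < n \<Longrightarrow> H i \<in> polys_z n"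
    and H_homogeneous: "i < n \<Longrightarrow> homogeneous 3 (H i)"
begin

definition f :: cpoly where
  "f = (\<Sum>i<n. var (Xi i) * H i)"

definition F :: "nat \<Rightarrow> cpoly" where
  "F i = var (Zv i) - H i"

text \<open>
  \<open>A m u\<close> is the summand \<open>A\<^sub>m(u) = \<E>(f\<^sup>m u) / m!\<close> of the power series \<open>\<A>(u)\<close>, and \<open>a d u\<close> is the
  homogeneous component of degree \<open>d\<close> of \<open>\<A>(u)\<close>. For \<open>u\<close> in \<open>\<complex>[z]\<close> the summands with \<open>2m > d\<close> have no
  component of degree \<open>d\<close>, so nothing is lost by stopping at \<open>m = d\<close>. Identities between power
  series are stated for all their components \<open>a d\<close>.
\<close>
definition A :: "nat \<Rightarrow> cpoly \<Rightarrow> cpoly" where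
  "A m u = cst (1 / fact m) * contr (f ^ m * u)"

definition a :: "nat \<Rightarrow> cpoly \<Rightarrow> cpoly" where
  "a d u = (\<Sum>m\<le>d. hc d (A m u))"

abbreviation J :: cpoly where "J \<equiv> jacobian_det n F"

text \<open>
  The adjugate of the Jacobian matrix, and the derivations that it defines. When \<open>J = 1\<close>,
  \<open>D k\<close> is the partial derivative with respect to \<open>F\<^sub>k\<close>.
\<close>
definition N :: "nat \<Rightarrow> nat \<Rightarrow> cpoly" where
  "N j k = adj_mat (jac_mat n F) $$ (j, k)"

definition D :: "nat \<Rightarrow> cpoly \<Rightarrow> cpoly" where
  "D k u = (\<Sum>j<n. N j k * pdiff (Zv j) u)"

lemma F_in: "i < n \<Longrightarrow> F i \<in> polys_z n"
  by (auto simp: F_def intro: polys_z_closed H_in)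

lemma N_in: "j < n \<Longrightarrow> k < n \<Longrightarrow> N j k \<in> polys_z n"
  using polys_in_adj_mat[of "jac_mat n F" n "Zv ` {..<n}"]
  by (simp add: N_def polys_z_pdiff F_in flip: polys_z_def)

lemma J_in: "J \<in> polys_z n"
  using polys_in_det[of "jac_mat n F" n "Zv ` {..<n}"]
  by (simp add: polys_z_pdiff F_in jacobian_det_eq flip: polys_z_def)

lemma D_in: "k < n \<Longrightarrow> u \<in> polys_z n \<Longrightarrow> D k u \<in> polys_z n"
  unfolding D_def by (intro polys_z_closed) (auto intro: N_in polys_z_pdiff)

lemma bihom_f: "bihom n 2 f"
proof -
  have "bihom n 3 (H i)" if "i < n" for i
    using that by (intro bihom_homogeneous H_in H_homogeneous)
  then show ?thesis unfolding f_def
    by (intro bihom_sum bihom_Xi_mult) (simp_all add: eval_nat_numeral)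
qed

lemma f_power_in: "u \<in> polys_z n \<Longrightarrow> f ^ m * u \<in> polys_xi_z n"
  using bihom_f polys_z_xi_z[of u n] by (auto simp: bihom_def polys_xi_z_def intro!: polys_in_closed)

lemma A_in: "u \<in> polys_z n \<Longrightarrow> A m u \<in> polys_z n"
  unfolding A_def by (intro polys_z_closed) (auto intro: contr_polys_z f_power_in)

lemma A_add: "A m (u + v) = A m u + A m v"
  by (simp add: A_def ring_distribs contr_add)

lemma A_0 [simp]: "A m 0 = 0"
  by (simp add: A_def)

lemma A_sum: "A m (sum g S) = (\<Sum>i\<in>S. A m (g i))"
  by (induction S rule: infinite_finite_induct) (simp_all add: A_add)

lemma A_first: "u \<in> polys_z n \<Longrightarrow> A 0 u = u"
  by (simp add: A_def contr_id)

lemma A_homogeneous: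
  assumes "u \<in> polys_z n" "homogeneous d u"
  shows "homogeneous (2 * m + d) (A m u)"
proof -
  have "homogeneous (m * 2 + d) (contr (f ^ m * u))"
    by (rule homogeneous_contr[OF bihom_mult[OF bihom_power[OF bihom_f] bihom_homogeneous[OF assms(2,1)]]])
  from homogeneous_mult[OF homogeneous_cst this] show ?thesis by (simp add: A_def mult.commute)
qed

lemma hc_A:
  assumes u: "u \<in> polys_z n"
  shows "hc e (A m u) = (if 2 * m \<le> e then A m (hc (e - 2 * m) u) else 0)"
proof -
  obtain K where K: "\<forall>d\<ge>K. hc d u = 0" using hc_bound by blast
  have "hc e (A m u) = hc e (A m (\<Sum>d<K. hc d u))" by (simp add: sum_hc[OF K])
  also have "\<dots> = (\<Sum>d<K. if e = 2 * m + d then A m (hc d u) else 0)"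
    unfolding A_sum hc_sum
    by (intro sum.cong hc_homogeneous refl A_homogeneous polys_z_hc u homogeneous_hc)
  also have "\<dots> = (\<Sum>d<K. if d = e - 2 * m then (if 2 * m \<le> e then A m (hc d u) else 0) else 0)"
    by (rule sum.cong) auto
  also have "\<dots> = (if 2 * m \<le> e then A m (hc (e - 2 * m) u) else 0)"
    using K by (auto simp: not_less)
  finally show ?thesis .
qed

text \<open>
  From \<open>\<partial>\<^sub>j f = \<Sum>\<^sub>i \<xi>\<^sub>i \<partial>\<^sub>j H\<^sub>i\<close> by the product rule: \<open>\<E>\<close> turns the factor \<open>\<xi>\<^sub>i\<close> into \<open>\<partial>\<^sub>i\<close>.
\<close>
lemma A_pdiff_Suc:
  "pdiff (Zv j) (A (Suc m) u) =
     A (Suc m) (pdiff (Zv j) u) + (\<Sum>i<n. pdiff (Zv i) (A m (u * pdiff (Zv j) (H i))))"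
proof -
  have df: "pdiff (Zv j) f = (\<Sum>i<n. var (Xi i) * pdiff (Zv j) (H i))"
    by (simp add: f_def pdiff_sum pdiff_mult pdiff_var)
  have c: "cst (1 / fact (Suc m)) * (of_nat (Suc m) * p) = cst (1 / fact m) * p" for p
  proof -
    have "cst (1 / fact (Suc m)) * of_nat (Suc m) = cst (1 / fact m)"
      unfolding cst_def single_of_nat[symmetric] mult_single by (simp del: of_nat_Suc)
    then show ?thesis by (metis mult.assoc)
  qed
  have o: "contr (of_nat k * p) = of_nat k * contr p" for k p
    by (induction k) (simp_all add: contr_add ring_distribs)
  have "pdiff (Zv j) (f ^ Suc m * u) = of_nat (Suc m) * (f ^ m * u * pdiff (Zv j) f) + f ^ Suc m * pdiff (Zv j) u"
    by (simp only: pdiff_mult pdiff_power) (simp add: algebra_simps)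
  then have "pdiff (Zv j) (A (Suc m) u) = 
      A (Suc m) (pdiff (Zv j) u) + cst (1 / fact m) * contr (f ^ m * u * pdiff (Zv j) f)"
    by (simp only: A_def pdiff_cst_mult contr_pdiff[symmetric] contr_add o c ring_distribs add.commute)
  also have "contr (f ^ m * u * pdiff (Zv j) f) = (\<Sum>i<n. contr (var (Xi i) * (f ^ m * (u * pdiff (Zv j) (H i)))))"
    by (simp add: df sum_distrib_left contr_sum mult_ac)
  also have "cst (1 / fact m) * \<dots> = (\<Sum>i<n. pdiff (Zv i) (A m (u * pdiff (Zv j) (H i))))"
    by (simp add: A_def contr_Xi pdiff_cst_mult sum_distrib_left)
  finally show ?thesis .
qed

lemma a_in: "u \<in> polys_z n \<Longrightarrow> a d u \<in> polys_z n"
  unfolding a_def by (intro polys_z_closed polys_z_hc A_in)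

lemma a_add: "a d (u + v) = a d u + a d v"
  by (simp add: a_def A_add hc_add sum.distrib)

lemma a_0 [simp]: "a d 0 = 0"
  by (simp add: a_def)

lemma a_sum: "a d (sum g S) = (\<Sum>i\<in>S. a d (g i))"
  by (induction S rule: infinite_finite_induct) (simp_all add: a_add)

lemma a_diff: "a d (u - v) = a d u - a d v"
  using a_add[of d "u - v" v] by simp

lemma a_homogeneous: "homogeneous d (a d u)"
  unfolding a_def by (intro homogeneous_sum homogeneous_hc)

lemma a_first: "u \<in> polys_z n \<Longrightarrow> a 0 u = hc 0 u"
  by (simp add: a_def A_first)

lemma a_pdiff:
  assumes u: "u \<in> polys_z n" and "j < n"
  shows "pdiff (Zv j) (a (Suc d) u) =
     a d (pdiff (Zv j) u) + (\<Sum>i<n. pdiff (Zv i) (a (Suc d) (u * pdiff (Zv j) (H i))))"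
proof -
  let ?d = "\<lambda>i. pdiff (Zv i)"
  have van: "hc e (A m v) = 0" if "v \<in> polys_z n" "2 * m > e" for e m v
    using that hc_A[of v e m] by simp
  have "?d j (a (Suc d) u) = (\<Sum>m\<le>Suc d. hc d (?d j (A m u)))"
    by (simp only: a_def pdiff_sum hc_pdiff)
  also have "\<dots> = hc d (A 0 (?d j u)) + (\<Sum>m\<le>d. hc d (A (Suc m) (?d j u)))
      + (\<Sum>m\<le>d. \<Sum>i<n. hc d (?d i (A m (u * ?d j (H i)))))"
    unfolding sum.atMost_Suc_shift A_pdiff_Suc
    by (simp add: A_first u polys_z_pdiff hc_add hc_sum sum.distrib)
  also have "hc d (A 0 (?d j u)) + (\<Sum>m\<le>d. hc d (A (Suc m) (?d j u))) = (\<Sum>m\<le>Suc d. hc d (A m (?d j u)))"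
    by (simp only: sum.atMost_Suc_shift)
  also have "\<dots> = a d (?d j u)"
    using u by (simp add: a_def van polys_z_pdiff)
  also have "(\<Sum>m\<le>d. \<Sum>i<n. hc d (?d i (A m (u * ?d j (H i))))) =
      (\<Sum>i<n. ?d i (\<Sum>m\<le>d. hc (Suc d) (A m (u * ?d j (H i)))))"
    by (subst sum.swap) (simp add: hc_pdiff pdiff_sum)
  also have "\<dots> = (\<Sum>i<n. ?d i (a (Suc d) (u * ?d j (H i))))"
  proof (rule sum.cong[OF refl])
    fix i assume "i \<in> {..<n}"
    then have "u * ?d j (H i) \<in> polys_z n" by (auto intro: polys_z_closed polys_z_pdiff u H_in)
    from van[OF this, of "Suc d" "Suc d"]
    show "?d i (\<Sum>m\<le>d. hc (Suc d) (A m (u * ?d j (H i)))) = ?d i (a (Suc d) (u * ?d j (H i)))"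
      by (simp add: a_def)
  qed
  finally show ?thesis .
qed

text \<open>
  The identity \<open>\<Sum>\<^sub>i \<partial>\<^sub>i \<A>(u \<partial>\<^sub>j F\<^sub>i) = \<A>(\<partial>\<^sub>j u)\<close>.
\<close>
lemma a_divergence:
  assumes u: "u \<in> polys_z n" and j: "j < n"
  shows "(\<Sum>i<n. pdiff (Zv i) (a (Suc d) (u * pdiff (Zv j) (F i)))) = a d (pdiff (Zv j) u)"
proof -
  have "(\<Sum>i<n. pdiff (Zv i) (a (Suc d) (u * pdiff (Zv j) (F i)))) =
    (\<Sum>i<n. (if i = j then pdiff (Zv j) (a (Suc d) u) else 0) - pdiff (Zv i) (a (Suc d) (u * pdiff (Zv j) (H i))))"
    by (rule sum.cong) (auto simp: F_def pdiff_diff pdiff_var ring_distribs a_diff)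
  also have "\<dots> = pdiff (Zv j) (a (Suc d) u) - (\<Sum>i<n. pdiff (Zv i) (a (Suc d) (u * pdiff (Zv j) (H i))))"
    using j by (simp add: sum_subtractf)
  also have "\<dots> = a d (pdiff (Zv j) u)"
    using a_pdiff[OF u j] by simp
  finally show ?thesis .
qed

lemma hc_0_J: "hc 0 J = 1"
proof -
  have "hc 0 1 = (1 :: cpoly)" using hc_cst[of 0 1] by simp
  then interpret h: comm_ring_hom "hc 0"
    by unfold_locales (simp_all add: hc_add hc_mult)
  have "map_mat (hc 0) (jac_mat n F) = 1\<^sub>m n"
  proof (rule eq_matI)
    fix i j assume ij: "i < dim_row (1\<^sub>m n :: cpoly mat)" "j < dim_col (1\<^sub>m n :: cpoly mat)"
    have "hc 1 (H i) = 0" using ij hc_homogeneous[OF H_homogeneous, of i 1] by simp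
    then have "hc 0 (pdiff (Zv j) (H i)) = 0" by (simp add: hc_pdiff)
    then show "map_mat (hc 0) (jac_mat n F) $$ (i, j) = 1\<^sub>m n $$ (i, j)"
      using ij by (auto simp: F_def pdiff_diff pdiff_var hc_diff)
  qed simp_all
  then show ?thesis using h.hom_det[of "jac_mat n F"] by (simp add: jacobian_det_eq)
qed

lemma J_nonzero: "J \<noteq> 0"
  using hc_0_J by auto

text \<open>
  The identity \<open>\<partial>\<^sub>k \<A>(u J) = \<A>(D\<^sub>k u)\<close>.
\<close>
lemma a_D:
  assumes u: "u \<in> polys_z n" and k: "k < n"
  shows "pdiff (Zv k) (a (Suc d) (u * J)) = a d (D k u)"
proof -
  have "(\<Sum>j<n. pdiff (Zv j) (u * N j k)) = D k u + u * (\<Sum>j<n. pdiff (Zv j) (N j k))"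
    by (simp add: D_def pdiff_mult sum.distrib sum_distrib_left mult.commute)
  then have "a d (D k u) = (\<Sum>j<n. a d (pdiff (Zv j) (u * N j k)))"
    using piola[OF J_nonzero k] by (simp add: N_def flip: a_sum)
  also have "\<dots> = (\<Sum>j<n. \<Sum>i<n. pdiff (Zv i) (a (Suc d) (u * N j k * pdiff (Zv j) (F i))))"
    using k by (intro sum.cong refl) (auto intro!: a_divergence[symmetric] polys_z_closed u N_in)
  also have "\<dots> = (\<Sum>i<n. pdiff (Zv i) (a (Suc d) (u * (\<Sum>j<n. pdiff (Zv j) (F i) * N j k))))"
    by (subst sum.swap) (simp add: sum_distrib_left a_sum pdiff_sum mult_ac)
  also have "\<dots> = (\<Sum>i<n. if i = k then pdiff (Zv i) (a (Suc d) (u * J)) else 0)"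
    by (rule sum.cong) (auto simp: N_def adj_jac_mat_right k)
  also have "\<dots> = pdiff (Zv k) (a (Suc d) (u * J))" using k by simp
  finally show ?thesis by simp
qed

lemma pdiff_all_eq_homogeneous:
  assumes "p \<in> polys_z n" "q \<in> polys_z n" "homogeneous (Suc d) p" "homogeneous (Suc d) q"
    and "\<And>k. k < n \<Longrightarrow> pdiff (Zv k) p = pdiff (Zv k) q"
  shows "p = q"
proof -
  have "p - q = hc 0 (p - q)"
    by (rule pdiff_all_zero[of _ "Zv ` {..<n}"])
      (use assms in \<open>auto simp: polys_z_def pdiff_diff intro: polys_in_diff\<close>)
  also have "\<dots> = 0" using assms(3,4) by (simp add: hc_diff hc_homogeneous)
  finally show ?thesis by simp
qed

lemma a_J: "a (Suc d) J = 0"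
proof -
  have *: "pdiff (Zv k) (a (Suc d) J) = 0" if "k < n" for k
    using a_D[of 1 k d] that by (simp add: D_def)
  show ?thesis
    by (rule pdiff_all_eq_homogeneous[of _ _ d]) (auto intro: a_in J_in a_homogeneous simp: *)
qed

text \<open>
  \<open>\<A>\<close> is injective: \<open>A\<^sub>0\<close> is the identity and the other \<open>A\<^sub>m\<close> raise degrees, so the lowest component of
  \<open>\<A>(u)\<close> is that of \<open>u\<close>.
\<close>
lemma a_inj:
  assumes u: "u \<in> polys_z n" and 0: "\<And>d. a d u = 0"
  shows "u = 0"
proof -
  have "hc d u = 0" for d
  proof (induction d rule: less_induct)
    case (less d)
    have "hc d (A (Suc m) u) = 0" for m
      using less[of "d - 2 * Suc m"] by (auto simp: hc_A u)
    then have "a d u = hc d u"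
      unfolding a_def by (cases d) (simp_all add: A_first u sum.atMost_Suc_shift del: sum.atMost_Suc)
    then show ?case using 0 by simp
  qed
  then show ?thesis by (metis hc_eqI hc_0)
qed

lemma a_homogeneous_eq:
  assumes "u \<in> polys_z n" "homogeneous e u"
  shows "a (2 * m + e) u = A m u"
proof -
  have "a (2 * m + e) u = (\<Sum>k\<le>2 * m + e. if k = m then A m u else 0)"
    unfolding a_def
    by (rule sum.cong) (auto simp: hc_homogeneous[OF A_homogeneous[OF assms]])
  then show ?thesis by simp
qed

lemma A_in_Im_Theta_iff: "u \<in> polys_z n \<Longrightarrow> f ^ m * u \<in> Im_Theta n \<longleftrightarrow> A m u = 0"
  by (subst Im_Theta_iff[OF f_power_in]) (auto simp: A_def cst_eq_0_iff)

lemma homogeneous_1: "homogeneous 0 1"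
  using homogeneous_cst[of 1] by simp

text \<open>
  Both conditions are equivalent to \<open>\<A>(1) = 1\<close>, because \<open>\<A>(J) = 1\<close> and \<open>\<A>\<close> is injective.
\<close>
theorem jacobian_eq_1_iff: "J = 1 \<longleftrightarrow> (\<forall>m\<ge>1. f ^ m \<in> Im_Theta n)"
proof -
  have *: "f ^ m \<in> Im_Theta n \<longleftrightarrow> A m 1 = 0" for m
    using A_in_Im_Theta_iff[of 1 m] by simp
  have "J = 1 \<longleftrightarrow> (\<forall>m\<ge>1. A m 1 = 0)"
  proof (intro iffI allI impI)
    fix m :: nat assume "J = 1" "m \<ge> 1"
    then obtain d where "2 * m = Suc d" by (cases m) auto
    then show "A m 1 = 0"
      using a_J[of d] a_homogeneous_eq[OF _ homogeneous_1, of m] \<open>J = 1\<close> by simp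
  next
    assume A: "\<forall>m\<ge>1. A m 1 = 0"
    have *: "a d (J - 1) = 0" for d
    proof (cases d)
      case 0
      have "hc 0 1 = (1 :: cpoly)" using hc_cst[of 0 1] by simp
      then show ?thesis using 0 by (simp add: a_diff a_first J_in hc_0_J)
    next
      case (Suc e)
      have "a d 1 = (\<Sum>m\<le>d. 0)"
        unfolding a_def
      proof (rule sum.cong[OF refl])
        fix m show "hc d (A m 1) = 0"
          using A Suc hc_cst[of d 1] by (cases "m = 0") (auto simp: A_first)
      qed
      then show ?thesis using Suc by (simp add: a_diff a_J)
    qed
    have "J - 1 = 0" by (rule a_inj) (auto intro: polys_z_closed J_in simp: *)
    then show "J = 1" by simp
  qed
  then show ?thesis by (simp add: *)
qed

context
  assumes J1: "J = 1"
begin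

lemma a_pdiff_D: "u \<in> polys_z n \<Longrightarrow> k < n \<Longrightarrow> pdiff (Zv k) (a (Suc d) u) = a d (D k u)"
  using a_D[of u k d] by (simp add: J1)

lemma D_mult: "D k (u * v) = D k u * v + u * D k v"
  by (simp add: D_def pdiff_mult sum.distrib sum_distrib_left sum_distrib_right ring_distribs mult_ac)

text \<open>
  \<open>\<A>\<close> is multiplicative. By induction, \<open>\<A>(u v)\<close> and \<open>\<A>(u) \<A>(v)\<close> have the same partial derivatives
  in each degree, since both sides turn \<open>\<partial>\<^sub>k\<close> into the derivation \<open>D\<^sub>k\<close>; their constant terms
  agree.
\<close>
lemma a_mult:
  assumes "u \<in> polys_z n" "v \<in> polys_z n"
  shows "a d (u * v) = (\<Sum>i\<le>d. a i u * a (d - i) v)"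
  using assms
proof (induction d arbitrary: u v)
  case 0
  then show ?case by (simp add: a_first polys_z_closed hc_mult)
next
  case (Suc d)
  have const: "pdiff (Zv k) (a 0 w) = 0" if "w \<in> polys_z n" for k w
  proof -
    have "homogeneous 0 (a 0 w)" by (rule a_homogeneous)
    then have "a 0 w = cst (Poly_Mapping.lookup (a 0 w) 0)"
      by (intro poly_mapping_eqI) (auto simp: cst_def lookup_single when_def homogeneous_def in_keys_iff)
    then show ?thesis by (metis pdiff_cst)
  qed
  show ?case
  proof (rule pdiff_all_eq_homogeneous)
    show "a (Suc d) (u * v) \<in> polys_z n" using Suc.prems by (intro a_in polys_z_closed)
    show "(\<Sum>i\<le>Suc d. a i u * a (Suc d - i) v) \<in> polys_z n" using Suc.prems by (intro a_in polys_z_closed)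
    show "homogeneous (Suc d) (\<Sum>i\<le>Suc d. a i u * a (Suc d - i) v)"
    proof (rule homogeneous_sum)
      fix i assume "i \<in> {..Suc d}"
      then show "homogeneous (Suc d) (a i u * a (Suc d - i) v)"
        using homogeneous_mult[OF a_homogeneous[of i u] a_homogeneous[of "Suc d - i" v]] by simp
    qed
    fix k assume k: "k < n"
    have "pdiff (Zv k) (\<Sum>i\<le>Suc d. a i u * a (Suc d - i) v) =
        (\<Sum>i\<le>Suc d. pdiff (Zv k) (a i u) * a (Suc d - i) v) + (\<Sum>i\<le>Suc d. a i u * pdiff (Zv k) (a (Suc d - i) v))"
      by (simp only: pdiff_sum pdiff_mult sum.distrib)
    also have "(\<Sum>i\<le>Suc d. pdiff (Zv k) (a i u) * a (Suc d - i) v) = (\<Sum>i\<le>d. a i (D k u) * a (d - i) v)"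
      unfolding sum.atMost_Suc_shift using Suc.prems k by (simp add: const a_pdiff_D)
    also have "(\<Sum>i\<le>Suc d. a i u * pdiff (Zv k) (a (Suc d - i) v)) = (\<Sum>i\<le>d. a i u * a (d - i) (D k v))"
      using Suc.prems k by (simp add: const Suc_diff_le a_pdiff_D)
    also have "(\<Sum>i\<le>d. a i (D k u) * a (d - i) v) + (\<Sum>i\<le>d. a i u * a (d - i) (D k v)) =
        a d (D k u * v) + a d (u * D k v)"
      using Suc.prems k by (simp add: Suc.IH D_in)
    also have "\<dots> = pdiff (Zv k) (a (Suc d) (u * v))"
      using Suc.prems k by (simp add: a_pdiff_D polys_z_closed D_mult a_add)
    finally show "pdiff (Zv k) (a (Suc d) (u * v)) = pdiff (Zv k) (\<Sum>i\<le>Suc d. a i u * a (Suc d - i) v)" by simp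
  qed (rule a_homogeneous)
qed

lemma a_cst: "a d (cst c) = hc d (cst c)"
proof (cases d)
  case (Suc e)
  have "a (Suc e) (cst c) = 0"
    by (rule pdiff_all_eq_homogeneous[of _ _ e]) (auto intro: a_in a_homogeneous simp: a_pdiff_D D_def)
  then show ?thesis using Suc by (simp add: hc_cst)
qed (simp add: a_first)

text \<open>
  \<open>\<A>(F\<^sub>j) = z\<^sub>j\<close>, because \<open>D\<^sub>k F\<^sub>j = \<delta>\<^sub>j\<^sub>k\<close>.
\<close>
lemma a_F:
  assumes j: "j < n"
  shows "a d (F j) = hc d (var (Zv j))"
proof (cases d)
  case 0
  then show ?thesis using j hc_homogeneous[OF H_homogeneous[OF j], of 0]
    by (simp add: a_first F_in) (simp add: F_def hc_diff)
next
  case (Suc e)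
  have *: "pdiff (Zv k) (a (Suc e) (F j)) = pdiff (Zv k) (hc (Suc e) (var (Zv j)))" if k: "k < n" for k
  proof -
    have "D k (F j) = cst (if j = k then 1 else 0)"
      using adj_jac_mat_right[OF j k, of F] by (simp add: D_def N_def J1 mult.commute)
    then show ?thesis using j k
      by (simp add: a_pdiff_D F_in a_cst pdiff_var flip: hc_pdiff)
  qed
  have "a (Suc e) (F j) = hc (Suc e) (var (Zv j))"
    by (rule pdiff_all_eq_homogeneous[of _ _ e])
      (auto simp: * j intro!: a_in a_homogeneous F_in polys_z_hc homogeneous_hc)
  then show ?thesis using Suc by simp
qed

text \<open>
  \<open>\<A>\<close> undoes the substitution of \<open>F\<close>.
\<close>
lemma a_sub_F: "p \<in> polys_z n \<Longrightarrow> a d (sub F p) = hc d p"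
proof (induction p arbitrary: d rule: polys_z_induct)
  case (mult p q)
  then show ?case by (simp add: sub_mult a_mult polys_z_sub F_in hc_mult)
qed (simp_all add: a_cst a_F sub_add a_add hc_add)

text \<open>
  If the \<open>\<A>(z\<^sub>j)\<close> are polynomials \<open>G\<^sub>j\<close>, then \<open>\<A>\<close> is the substitution of \<open>G\<close>.
\<close>
lemma a_eq_hc_sub:
  assumes G: "\<And>j. j < n \<Longrightarrow> G j \<in> polys_z n" "\<And>j d. j < n \<Longrightarrow> a d (var (Zv j)) = hc d (G j)"
  shows "p \<in> polys_z n \<Longrightarrow> a d p = hc d (sub G p)"
proof (induction p arbitrary: d rule: polys_z_induct)
  case (mult p q)
  then show ?case by (simp add: sub_mult a_mult hc_mult)
qed (simp_all add: a_cst G sub_add a_add hc_add)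

lemma A_vanishes_of_inverse:
  assumes G: "poly_inverse n F G" and j: "j < n"
  shows "\<exists>N. \<forall>m\<ge>N. A m (var (Zv j)) = 0"
proof -
  obtain K where K: "\<forall>d\<ge>K. hc d (G j) = 0" using hc_bound by blast
  have "A m (var (Zv j)) = 0" if "m \<ge> K" for m
  proof -
    have "A m (var (Zv j)) = a (2 * m + 1) (var (Zv j))"
      using a_homogeneous_eq[OF _ homogeneous_var] j by simp
    also have "\<dots> = a (2 * m + 1) (sub F (G j))" using G j by (simp add: poly_inverse_def)
    also have "\<dots> = hc (2 * m + 1) (G j)" using G j by (intro a_sub_F) (simp add: poly_inverse_def)
    also have "\<dots> = 0" using K that by simp
    finally show ?thesis .
  qed
  then show ?thesis by blast
qed

lemma inverse_of_A_vanishes: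
  assumes "\<And>j. j < n \<Longrightarrow> \<exists>N. \<forall>m\<ge>N. A m (var (Zv j)) = 0"
  shows "\<exists>G. poly_inverse n F G"
proof -
  from assms obtain K where K: "\<And>j m. j < n \<Longrightarrow> m \<ge> K j \<Longrightarrow> A m (var (Zv j)) = 0" by metis
  define G where "G j = (\<Sum>m<K j. A m (var (Zv j)))" for j
  have G_in: "G j \<in> polys_z n" if "j < n" for j
    unfolding G_def using that by (intro polys_z_closed A_in) simp
  have G_hc: "a d (var (Zv j)) = hc d (G j)" if j: "j < n" for d j
  proof -
    have "a d (var (Zv j)) = (\<Sum>m\<in>{..d} \<inter> {..<K j}. hc d (A m (var (Zv j))))"
      unfolding a_def by (rule sum.mono_neutral_right) (use j K in \<open>force simp: not_less\<close>)+
    also have "\<dots> = (\<Sum>m<K j. hc d (A m (var (Zv j))))"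
      by (rule sum.mono_neutral_left) (use j in \<open>auto simp: hc_A\<close>)
    finally show ?thesis by (simp add: G_def hc_sum)
  qed
  have 1: "sub G (F j) = var (Zv j)" if "j < n" for j
    by (rule hc_eqI) (use that in \<open>simp add: a_F[symmetric] a_eq_hc_sub[OF G_in G_hc, symmetric] F_in\<close>)
  \<comment> \<open>\<open>\<A>(G\<^sub>j(F)) = G\<^sub>j = \<A>(z\<^sub>j)\<close>, and \<open>\<A>\<close> is injective.\<close>
  have 2: "sub F (G j) = var (Zv j)" if "j < n" for j
  proof -
    have "sub F (G j) - var (Zv j) = 0"
      by (rule a_inj) (use that in \<open>auto simp: a_diff a_sub_F G_in G_hc intro!: polys_z_closed polys_z_sub F_in\<close>)
    then show ?thesis by simp
  qed
  show ?thesis using 1 2 G_in by (auto simp: poly_inverse_def)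
qed

end

theorem image_conjecture_iff:
  "(\<forall>j<n. image_conjecture_for n f (var (Zv j))) \<longleftrightarrow> (J = 1 \<longrightarrow> (\<exists>G. poly_inverse n F G))"
proof -
  have "(\<forall>j<n. \<exists>N. \<forall>m\<ge>N. f ^ m * var (Zv j) \<in> Im_Theta n) \<longleftrightarrow> (\<exists>G. poly_inverse n F G)" if J: "J = 1"
    using A_vanishes_of_inverse[OF J] inverse_of_A_vanishes[OF J] by (auto simp: A_in_Im_Theta_iff)
  then show ?thesis
    unfolding image_conjecture_for_def jacobian_eq_1_iff by blast
qed

end

section \<open>Invertible polynomial maps\<close>

text \<open>
  Invertibility with a polynomial inverse, as an identity of polynomials.
\<close>
definition poly_invertible :: "nat \<Rightarrow> (nat \<Rightarrow> cpoly) \<Rightarrow> bool" where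
  "poly_invertible n F \<longleftrightarrow> (\<exists>G. poly_inverse n F G)"

lemma sub_cong:
  assumes "p \<in> polys_z n" "\<And>i. i < n \<Longrightarrow> F i = G i"
  shows "sub F p = sub G p"
  using assms(1) by (induction p rule: polys_z_induct) (simp_all add: assms(2) sub_add sub_mult)

lemma sub_id:
  assumes "p \<in> polys_z n" "\<And>i. i < n \<Longrightarrow> F i = var (Zv i)"
  shows "sub F p = p"
  using assms(1) by (induction p rule: polys_z_induct) (simp_all add: assms(2) sub_add sub_mult)

lemma sub_comp: "sub G (sub F p) = sub (\<lambda>i. sub G (F i)) p"
proof (induction p rule: cpoly_induct)
  case (var v)
  show ?case by (cases v) simp_all
qed (simp_all add: sub_add sub_mult)

lemma poly_inverse_sub:
  assumes "poly_inverse n F G" "p \<in> polys_z n"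
  shows "sub F (sub G p) = p" "sub G (sub F p) = p"
  unfolding sub_comp using assms by (auto intro!: sub_id simp: poly_inverse_def)

lemma poly_inverse_cong:
  assumes "poly_inverse n F G" "\<And>i. i < n \<Longrightarrow> F' i = F i"
  shows "poly_inverse n F' G"
  unfolding poly_inverse_def
proof (intro allI impI conjI)
  fix i assume i: "i < n"
  show G: "G i \<in> polys_z n" using assms i by (simp add: poly_inverse_def)
  show "sub F' (G i) = var (Zv i)"
    using assms i sub_cong[OF G, of F' F] by (simp add: poly_inverse_def)
  show "sub G (F' i) = var (Zv i)" using assms i by (simp add: poly_inverse_def)
qed

lemma poly_inverse_comp:
  assumes F: "poly_inverse n F F'" "\<And>i. i < n \<Longrightarrow> F i \<in> polys_z n"
    and G: "poly_inverse n G G'" "\<And>i. i < n \<Longrightarrow> G i \<in> polys_z n"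
  shows "poly_inverse n (\<lambda>i. sub G (F i)) (\<lambda>i. sub F' (G' i))"
  unfolding poly_inverse_def
proof (intro allI impI conjI)
  fix i assume i: "i < n"
  have *: "G' j \<in> polys_z n" "F' j \<in> polys_z n" "sub G (G' j) = var (Zv j)" "sub F' (F j) = var (Zv j)"
    if "j < n" for j
    using that F G by (auto simp: poly_inverse_def)
  show "sub F' (G' i) \<in> polys_z n" using i by (intro polys_z_sub[of _ n] *)
  show "sub (\<lambda>i. sub G (F i)) (sub F' (G' i)) = var (Zv i)"
    using i by (simp add: * poly_inverse_sub[OF F(1)] flip: sub_comp)
  show "sub (\<lambda>i. sub F' (G' i)) (sub G (F i)) = var (Zv i)"
    using i by (simp add: * poly_inverse_sub[OF G(1)] F(2) flip: sub_comp)
qed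

lemma poly_inverse_sym:
  "poly_inverse n F G \<Longrightarrow> (\<And>i. i < n \<Longrightarrow> F i \<in> polys_z n) \<Longrightarrow> poly_inverse n G F"
  by (simp add: poly_inverse_def)

text \<open>
  If \<open>E2 \<circ> F \<circ> E1\<close> is invertible, so is \<open>F = E2\<^sup>-\<^sup>1 \<circ> (E2 \<circ> F \<circ> E1) \<circ> E1\<^sup>-\<^sup>1\<close>.
\<close>
lemma poly_invertible_sandwich:
  assumes in_z: "\<And>i. i < n \<Longrightarrow> F i \<in> polys_z n" "\<And>i. i < n \<Longrightarrow> E1 i \<in> polys_z n" "\<And>i. i < n \<Longrightarrow> E2 i \<in> polys_z n"
    and E: "poly_inverse n E1 E1'" "poly_inverse n E2 E2'"
    and inv: "poly_invertible n (\<lambda>i. sub E1 (sub F (E2 i)))"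
  shows "poly_invertible n F"
proof -
  let ?K = "\<lambda>i. sub E1 (sub F (E2 i))"
  from inv obtain L where L: "poly_inverse n ?K L" by (auto simp: poly_invertible_def)
  have E1': "poly_inverse n E1' E1" "poly_inverse n E2' E2"
    and E'_in: "\<And>i. i < n \<Longrightarrow> E1' i \<in> polys_z n" "\<And>i. i < n \<Longrightarrow> E2' i \<in> polys_z n"
    using E in_z by (auto intro: poly_inverse_sym simp: poly_inverse_def[of _ E1] poly_inverse_def[of _ E2])
  have K_in: "?K i \<in> polys_z n" if "i < n" for i
    using that by (intro polys_z_sub[of _ n] in_z)
  have 1: "poly_inverse n (\<lambda>i. sub ?K (E2' i)) (\<lambda>i. sub E2 (L i))"
    by (rule poly_inverse_comp[OF E1'(2) E'_in(2) L K_in])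
  have 2: "sub ?K (E2' i) \<in> polys_z n" if "i < n" for i
    by (intro polys_z_sub[of _ n] K_in E'_in that)
  have "poly_inverse n (\<lambda>i. sub E1' (sub ?K (E2' i))) (\<lambda>i. sub (\<lambda>i. sub E2 (L i)) (E1 i))"
    by (rule poly_inverse_comp[OF 1 2 E1'(1) E'_in(1)])
  moreover have "sub E1' (sub ?K (E2' i)) = F i" if "i < n" for i
  proof -
    have "sub ?K (E2' i) = sub E1 (sub F (sub E2 (E2' i)))" by (simp only: sub_comp)
    also have "\<dots> = sub E1 (F i)" using E(2) that by (simp add: poly_inverse_def)
    finally show ?thesis using poly_inverse_sub(2)[OF E(1) in_z(1)[OF that]] by simp
  qed
  ultimately show ?thesis unfolding poly_invertible_def by (metis (no_types, lifting) poly_inverse_cong)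
qed

text \<open>
  If \<open>F'\<close> fixes the variables from \<open>z\<^sub>n\<close> on, then giving constant values to them in \<open>F'\<close> and in its
  inverse yields a map in \<open>n\<close> variables together with its inverse.
\<close>
lemma poly_inverse_specialize:
  assumes Q: "poly_inverse N F' Q" and n: "n \<le> N"
    and \<rho>: "\<And>j. j < n \<Longrightarrow> \<rho> j = var (Zv j)" "\<And>j. n \<le> j \<Longrightarrow> j < N \<Longrightarrow> \<rho> j = cst (c j)"
    and F': "\<And>j. j < N \<Longrightarrow> F' j \<in> polys_z N" "\<And>j. n \<le> j \<Longrightarrow> j < N \<Longrightarrow> F' j = var (Zv j)"
    and F: "\<And>j. j < n \<Longrightarrow> F j = sub \<rho> (F' j)"
  shows "poly_inverse n F (\<lambda>i. sub \<rho> (Q i))"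
  unfolding poly_inverse_def
proof (intro allI impI conjI)
  fix i assume i: "i < n"
  have Q': "Q j \<in> polys_z N" "sub F' (Q j) = var (Zv j)" "sub Q (F' j) = var (Zv j)" if "j < N" for j
    using Q that by (auto simp: poly_inverse_def)
  have \<rho>_in: "\<rho> j \<in> polys_z n" if "j < N" for j using \<rho> that by (cases "j < n") auto
  show "sub \<rho> (Q i) \<in> polys_z n" using i n by (intro polys_z_sub[of _ N] Q' \<rho>_in) auto
  have "sub F (sub \<rho> (Q i)) = sub \<rho> (sub F' (Q i))"
    unfolding sub_comp
  proof (rule sub_cong[of _ N])
    fix j assume "j < N"
    then show "sub F (\<rho> j) = sub \<rho> (F' j)"
      by (cases "j < n") (simp_all add: \<rho> F F')
  qed (use i n Q' in auto)
  then show "sub F (sub \<rho> (Q i)) = var (Zv i)" using i n \<rho> by (simp add: Q')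
  have "sub (\<lambda>i. sub \<rho> (Q i)) (F i) = sub (\<lambda>j. sub (\<lambda>i. sub \<rho> (Q i)) (\<rho> j)) (F' i)"
    by (simp add: F i sub_comp)
  also have "\<dots> = sub (\<lambda>j. sub \<rho> (Q j)) (F' i)"
  proof (rule sub_cong[of _ N])
    fix j assume j: "j < N"
    show "sub (\<lambda>i. sub \<rho> (Q i)) (\<rho> j) = sub \<rho> (Q j)"
    proof (cases "j < n")
      case False
      then have "Q j = var (Zv j)" using j F'(2)[of j] Q'(3)[of j] by simp
      then show ?thesis using False j by (simp add: \<rho>)
    qed (simp add: \<rho>)
  qed (use i n F' in auto)
  also have "\<dots> = sub \<rho> (sub Q (F' i))" by (simp add: sub_comp)
  also have "\<dots> = var (Zv i)" using i n by (simp add: Q' \<rho>)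
  finally show "sub (\<lambda>i. sub \<rho> (Q i)) (F i) = var (Zv i)" .
qed

section \<open>Rules for Jacobian determinants\<close>

lemma jacobian_det_cong: "(\<And>i. i < n \<Longrightarrow> F i = G i) \<Longrightarrow> jacobian_det n F = jacobian_det n G"
  unfolding jacobian_det_eq by (rule arg_cong[of _ _ det]) (auto simp: jac_mat_def)

text \<open>
  The chain rule.
\<close>
lemma pdiff_sub:
  assumes "p \<in> polys_z n"
  shows "pdiff (Zv j) (sub G p) = (\<Sum>k<n. sub G (pdiff (Zv k) p) * pdiff (Zv j) (G k))"
  using assms
proof (induction p rule: polys_z_induct)
  case (var i)
  have "(\<Sum>k<n. sub G (pdiff (Zv k) (var (Zv i))) * pdiff (Zv j) (G k)) =
     (\<Sum>k<n. if k = i then pdiff (Zv j) (G k) else 0)"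
    by (rule sum.cong) (auto simp: pdiff_var)
  then show ?case using var by simp
next
  case (mult p q)
  then show ?case
    by (simp add: sub_mult pdiff_mult sub_add ring_distribs sum.distrib sum_distrib_left sum_distrib_right mult_ac)
qed (simp_all add: sub_add pdiff_add ring_distribs sum.distrib)

lemma jacobian_det_sub:
  assumes "\<And>i. i < n \<Longrightarrow> F i \<in> polys_z n"
  shows "jacobian_det n (\<lambda>i. sub G (F i)) = sub G (jacobian_det n F) * jacobian_det n G"
proof -
  have "jac_mat n (\<lambda>i. sub G (F i)) = map_mat (sub G) (jac_mat n F) * jac_mat n G"
    by (rule eq_matI)
      (auto simp: scalar_prod_def pdiff_sub[OF assms] lessThan_atLeast0 intro!: sum.cong)
  then show ?thesis
    by (simp add: jacobian_det_eq det_mult[of _ n] comm_ring_hom.hom_det[OF comm_ring_hom_sub])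
qed

lemma jacobian_det_triangular:
  assumes diag: "\<And>i. i < n \<Longrightarrow> pdiff (Zv i) (F i) = 1"
    and tri: "(\<forall>j<n. \<forall>i<j. pdiff (Zv j) (F i) = 0) \<or> (\<forall>i<n. \<forall>j<i. pdiff (Zv j) (F i) = 0)"
  shows "jacobian_det n F = 1"
proof -
  have "det (jac_mat n F) = prod_list (diag_mat (jac_mat n F))"
    using tri
  proof
    assume "\<forall>j<n. \<forall>i<j. pdiff (Zv j) (F i) = 0"
    then show ?thesis by (intro det_lower_triangular[of n]) auto
  next
    assume "\<forall>i<n. \<forall>j<i. pdiff (Zv j) (F i) = 0"
    then show ?thesis by (intro det_upper_triangular[of _ n]) auto
  qed
  also have "diag_mat (jac_mat n F) = map (\<lambda>_. 1) [0..<n]"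
    unfolding diag_mat_def by (rule map_cong) (auto simp: diag)
  finally show ?thesis by (simp add: jacobian_det_eq map_replicate_const)
qed

text \<open>
  The components \<open>F i\<close> with \<open>i < n\<close> may involve all variables: the Jacobian matrix is block
  upper triangular in any case.
\<close>
lemma jacobian_det_extend:
  assumes "n \<le> N" "\<And>i. n \<le> i \<Longrightarrow> i < N \<Longrightarrow> F i = var (Zv i)"
  shows "jacobian_det N F = jacobian_det n F"
proof -
  let ?B = "mat n (N - n) (\<lambda>(i, j). pdiff (Zv (n + j)) (F i))"
  have "jac_mat N F = four_block_mat (jac_mat n F) ?B (0\<^sub>m (N - n) n) (1\<^sub>m (N - n))"
    by (rule eq_matI) (use assms in \<open>auto simp: pdiff_var\<close>)
  then show ?thesis
    by (simp add: jacobian_det_eq det_four_block_mat_lower_left_zero[of _ n _ "N - n"])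
qed

section \<open>Adding variables and composing with elementary maps\<close>

text \<open>
  The map \<open>z + p\<close> has the inverse \<open>z - p\<close> if both maps leave \<open>p\<close> fixed.
\<close>
lemma poly_inverse_elementary:
  assumes "\<And>i. i < n \<Longrightarrow> p i \<in> polys_z n"
    and "\<And>i. i < n \<Longrightarrow> sub (\<lambda>i. var (Zv i) + p i) (p i) = p i"
    and "\<And>i. i < n \<Longrightarrow> sub (\<lambda>i. var (Zv i) - p i) (p i) = p i"
  shows "poly_inverse n (\<lambda>i. var (Zv i) + p i) (\<lambda>i. var (Zv i) - p i)"
  unfolding poly_inverse_def using assms
  by (auto simp: sub_add sub_diff intro: polys_z_closed)

lemma sub_fixed:
  assumes "p \<in> polys_in (Zv ` S)" "\<And>i. i \<in> S \<Longrightarrow> F i = var (Zv i)"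
  shows "sub F p = p"
  using assms(1) by (induction p rule: polys_in_induct) (auto simp: assms(2) sub_add sub_mult)

text \<open>
  \<open>K = (z + q) \<circ> F \<circ> (z + r)\<close>, where \<open>r\<close> changes only variables from \<open>z\<^bsub>n'\<^esub>\<close> on and \<open>q\<close> changes
  only the variables before \<open>z\<^sub>n\<close>, both by polynomials in variables that they do not change. The two
  elementary maps are triangular with Jacobian determinant 1.
\<close>
lemma stabilize:
  assumes n: "n \<le> n'" "n' \<le> N"
    and F: "\<And>i. i < n \<Longrightarrow> F i \<in> polys_z n'" "\<And>i. n \<le> i \<Longrightarrow> F i = var (Zv i)"
    and q: "\<And>i. i < n \<Longrightarrow> q i \<in> polys_in (Zv ` {n..<N})" "\<And>i. n \<le> i \<Longrightarrow> q i = 0"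
    and r: "\<And>i. i < N \<Longrightarrow> r i \<in> polys_z n'" "\<And>i. i < n' \<Longrightarrow> r i = 0"
    and K: "\<And>i. i < n \<Longrightarrow> K i = F i + sub (\<lambda>i. var (Zv i) + r i) (q i)"
      "\<And>i. n \<le> i \<Longrightarrow> K i = var (Zv i) + r i"
    and J: "jacobian_det n F = 1"
  shows "jacobian_det N K = 1" and "poly_invertible N K \<Longrightarrow> poly_invertible N F"
proof -
  define E1 where "E1 i = var (Zv i) + r i" for i
  define E2 where "E2 i = var (Zv i) + q i" for i
  have q_in: "q i \<in> polys_z N" for i
    using q polys_in_mono[of "Zv ` {n..<N}" "Zv ` {..<N}"] by (cases "i < n") (force simp: polys_z_def)+
  have F_in: "F i \<in> polys_z N" if "i < N" for i
    using that F n polys_z_mono[of n' N] by (cases "i < n") auto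
  have r_in: "r i \<in> polys_z N" if "i < N" for i
    using that r n polys_z_mono[of n' N] by auto
  have E1_in: "E1 i \<in> polys_z N" and E2_in: "E2 i \<in> polys_z N" if "i < N" for i
    using that r_in q_in by (auto simp: E1_def E2_def intro: polys_z_closed)
  have K_eq: "K i = sub E1 (sub F (E2 i))" for i
  proof (cases "i < n")
    case True
    have "sub F (q i) = q i" using q(1)[OF True] F(2) by (intro sub_fixed) auto
    moreover have "sub E1 (F i) = F i" using F(1)[OF True] r(2) by (intro sub_id) (auto simp: E1_def)
    ultimately show ?thesis using True K by (simp add: E2_def sub_add E1_def[abs_def])
  next
    case False
    then show ?thesis by (simp add: K E2_def E1_def F q)
  qed
  have E1_inv: "poly_inverse N E1 (\<lambda>i. var (Zv i) - r i)"
    unfolding E1_def using r by (intro poly_inverse_elementary r_in) (auto intro!: sub_id)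
  have E2_inv: "poly_inverse N E2 (\<lambda>i. var (Zv i) - q i)"
    unfolding E2_def
  proof (intro poly_inverse_elementary q_in)
    fix i assume "i < N"
    show "sub (\<lambda>i. var (Zv i) + q i) (q i) = q i" "sub (\<lambda>i. var (Zv i) - q i) (q i) = q i"
      using q by (cases "i < n"; auto intro!: sub_fixed)+
  qed
  have E1_J: "jacobian_det N E1 = 1"
  proof (rule jacobian_det_triangular)
    have *: "pdiff (Zv j) (r i) = 0" if "i \<le> j" "i < N" for i j
    proof (cases "i < n'")
      case False
      then show ?thesis
        using that r(1)[of i] by (auto simp: polys_z_def intro: pdiff_outside)
    qed (simp add: r)
    then show "pdiff (Zv i) (E1 i) = 1" if "i < N" for i
      using that by (simp add: E1_def pdiff_add pdiff_var)
    show "(\<forall>j<N. \<forall>i<j. pdiff (Zv j) (E1 i) = 0) \<or> (\<forall>i<N. \<forall>j<i. pdiff (Zv j) (E1 i) = 0)"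
      using * by (auto simp: E1_def pdiff_add pdiff_var)
  qed
  have E2_J: "jacobian_det N E2 = 1"
  proof (rule jacobian_det_triangular)
    have *: "pdiff (Zv j) (q i) = 0" if "j \<le> i" for i j
    proof (cases "i < n")
      case True
      then show ?thesis
        using that q(1)[of i] by (auto intro!: pdiff_outside)
    qed (simp add: q)
    then show "pdiff (Zv i) (E2 i) = 1" if "i < N" for i
      by (simp add: E2_def pdiff_add pdiff_var)
    show "(\<forall>j<N. \<forall>i<j. pdiff (Zv j) (E2 i) = 0) \<or> (\<forall>i<N. \<forall>j<i. pdiff (Zv j) (E2 i) = 0)"
      using * by (auto simp: E2_def pdiff_add pdiff_var)
  qed
  have F_J: "jacobian_det N F = 1" using J n F(2) jacobian_det_extend[of n N F] by simp
  have K_fun: "K = (\<lambda>i. sub E1 (sub F (E2 i)))" using K_eq by blast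
  have "sub F (E2 i) \<in> polys_z N" if "i < N" for i
    by (intro polys_z_sub[of _ N] E2_in F_in that)
  then show "jacobian_det N K = 1"
    unfolding K_fun by (simp add: jacobian_det_sub E2_in E1_J E2_J F_J)
  show "poly_invertible N F" if "poly_invertible N K"
    by (rule poly_invertible_sandwich[OF _ _ _ E1_inv E2_inv])
      (use that F_in E1_in E2_in in \<open>simp_all add: K_fun\<close>)
qed

section \<open>Reduction to cubic homogeneous maps\<close>

text \<open>
  The Jacobian conjecture, in all dimensions, for the maps \<open>z - H\<close> with \<open>H\<close> homogeneous of degree 3.
\<close>
definition cubic_homogeneous_case :: bool where
  "cubic_homogeneous_case \<longleftrightarrow> (\<forall>n\<ge>1. \<forall>H. (\<forall>i<n. H i \<in> polys_z n \<and> homogeneous 3 (H i)) \<longrightarrow>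
     jacobian_det n (\<lambda>i. var (Zv i) - H i) = 1 \<longrightarrow> poly_invertible n (\<lambda>i. var (Zv i) - H i))"

lemma sub_scale_hc:
  assumes "p \<in> polys_z n" "\<And>i. i < n \<Longrightarrow> T i = t * var (Zv i)"
  shows "sub T (hc d p) = t ^ d * hc d p"
  using assms(1)
proof (induction p arbitrary: d rule: polys_z_induct)
  case (mult p q)
  have "sub T (hc d (p * q)) = (\<Sum>i\<le>d. t ^ i * hc i p * (t ^ (d - i) * hc (d - i) q))"
    by (simp add: hc_mult sub_sum sub_mult mult)
  also have "\<dots> = (\<Sum>i\<le>d. t ^ d * (hc i p * hc (d - i) q))"
  proof (rule sum.cong[OF refl])
    fix i assume "i \<in> {..d}"
    then have "t ^ d = t ^ i * t ^ (d - i)" by (simp flip: power_add)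
    then show "t ^ i * hc i p * (t ^ (d - i) * hc (d - i) q) = t ^ d * (hc i p * hc (d - i) q)"
      by (simp add: mult_ac)
  qed
  finally show ?case by (simp add: hc_mult sum_distrib_left)
qed (simp_all add: hc_cst hc_var assms(2) hc_add sub_add ring_distribs)

lemma sub_scale:
  assumes "p \<in> polys_z n" "homogeneous d p" "\<And>i. i < n \<Longrightarrow> T i = t * var (Zv i)"
  shows "sub T p = t ^ d * p"
  using sub_scale_hc[OF assms(1,3), of d] hc_homogeneous[OF assms(2), of d] by simp

lemma homogeneous_pdiff: "homogeneous (Suc d) p \<Longrightarrow> homogeneous d (pdiff v p)"
  using homogeneous_hc[of d "pdiff v p"] by (simp add: hc_pdiff hc_homogeneous)

lemma homogeneous_var_mult: "homogeneous d p \<Longrightarrow> homogeneous (Suc d) (var v * p)"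
  using homogeneous_mult[OF homogeneous_var] by simp

text \<open>
  In the variables \<open>x\<^sub>0, \<dots>, x\<^bsub>n-1\<^esub>, t, y\<^sub>0, \<dots>, y\<^bsub>n-1\<^esub>\<close>, compose \<open>y \<mapsto> y + C(x)\<close>, then
  \<open>x \<mapsto> x + t P(x) + t\<^sup>2 C(x)\<close>, then \<open>x \<mapsto> x - t\<^sup>2 y\<close>. The terms \<open>t\<^sup>2 C(x)\<close> cancel, and what remains,
  \<open>(x + t P(x) - t\<^sup>2 y, t, y + C(x))\<close>, is the identity plus a cubic homogeneous map. The given map is
  recovered at \<open>t = 1\<close>.
\<close>
lemma quadratic_cubic_invertible:
  assumes cubic: cubic_homogeneous_case
    and P: "\<And>i. i < n \<Longrightarrow> P i \<in> polys_z n" "\<And>i. i < n \<Longrightarrow> homogeneous 2 (P i)"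
    and C: "\<And>i. i < n \<Longrightarrow> C i \<in> polys_z n" "\<And>i. i < n \<Longrightarrow> homogeneous 3 (C i)"
    and F: "\<And>i. i < n \<Longrightarrow> F i = var (Zv i) + P i + C i"
    and J: "jacobian_det n F = 1"
  shows "poly_invertible n F"
proof -
  define t where "t = var (Zv n)"
  define N where "N = 2 * n + 1"
  define y where "y i = var (Zv (n + 1 + i))" for i
  define F' where "F' i = (if i < n then var (Zv i) + t * P i + t\<^sup>2 * C i else var (Zv i))" for i
  define q where "q i = (if i < n then - (t\<^sup>2 * y i) else 0)" for i
  define r where "r i = (if n + 1 \<le> i \<and> i < N then C (i - (n + 1)) else 0)" for i
  define H where "H i = (if i < n then t\<^sup>2 * y i - t * P i else - r i)" for i
  define K where "K i = var (Zv i) - H i" for i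
  have up: "p \<in> polys_z (n + 1)" if "p \<in> polys_z n" for p using that polys_z_mono[of n "n + 1"] by simp
  have up': "p \<in> polys_z N" if "p \<in> polys_z n" for p using that polys_z_mono[of n N] by (simp add: N_def)
  have F'_in: "F' i \<in> polys_z (n + 1)" if "i < n" for i
    using that up[OF P(1)[OF that]] up[OF C(1)[OF that]]
    by (auto simp: F'_def t_def intro!: polys_z_closed)
  \<comment> \<open>The Jacobian matrix of \<open>z + t P + t\<^sup>2 C\<close> is that of \<open>z + P + C\<close> at the point \<open>t z\<close>.\<close>
  have "jacobian_det n F' = sub (\<lambda>i. t * var (Zv i)) (jacobian_det n F)"
  proof -
    have "jac_mat n F' = map_mat (sub (\<lambda>i. t * var (Zv i))) (jac_mat n F)"
    proof (rule eq_matI)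
      fix i j assume "i < dim_row (map_mat (sub (\<lambda>i. t * var (Zv i))) (jac_mat n F))"
        "j < dim_col (map_mat (sub (\<lambda>i. t * var (Zv i))) (jac_mat n F))"
      then have ij: "i < n" "j < n" by simp_all
      have "homogeneous 1 (pdiff (Zv j) (P i))" "homogeneous 2 (pdiff (Zv j) (C i))"
        using P(2)[OF ij(1)] C(2)[OF ij(1)] by (auto intro: homogeneous_pdiff simp: eval_nat_numeral)
      then have "sub (\<lambda>i. t * var (Zv i)) (pdiff (Zv j) (P i)) = t * pdiff (Zv j) (P i)"
        "sub (\<lambda>i. t * var (Zv i)) (pdiff (Zv j) (C i)) = t\<^sup>2 * pdiff (Zv j) (C i)"
        using sub_scale[OF polys_z_pdiff[OF P(1)[OF ij(1)]], of 1 "Zv j" "\<lambda>i. t * var (Zv i)" t]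
          sub_scale[OF polys_z_pdiff[OF C(1)[OF ij(1)]], of 2 "Zv j" "\<lambda>i. t * var (Zv i)" t]
        by simp_all
      then show "jac_mat n F' $$ (i, j) = map_mat (sub (\<lambda>i. t * var (Zv i))) (jac_mat n F) $$ (i, j)"
        using ij by (auto simp: F F'_def t_def pdiff_add pdiff_mult pdiff_power pdiff_var power2_eq_square sub_add)
    qed simp_all
    then show ?thesis
      by (simp add: jacobian_det_eq comm_ring_hom.hom_det[OF comm_ring_hom_sub])
  qed
  then have J': "jacobian_det n F' = 1" using J by simp
  have K1: "K i = F' i + sub (\<lambda>i. var (Zv i) + r i) (q i)" if "i < n" for i
    using that by (simp add: K_def H_def F'_def q_def r_def N_def t_def y_def sub_uminus sub_mult sub_power)
      (simp add: algebra_simps)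
  have K2: "K i = var (Zv i) + r i" if "n \<le> i" for i
    using that by (simp add: K_def H_def)
  have q_in: "q i \<in> polys_in (Zv ` {n..<N})" if "i < n" for i
    using that by (auto simp: q_def t_def y_def N_def intro!: polys_in_closed)
  have r_in: "r i \<in> polys_z (n + 1)" if "i < N" for i
    using that up[OF C(1)[of "i - (n + 1)"]] by (auto simp: r_def N_def)
  have "n \<le> n + 1" "n + 1 \<le> N" "n \<le> N" by (simp_all add: N_def)
  have F'_out: "F' i = var (Zv i)" if "n \<le> i" for i using that by (simp add: F'_def)
  have q_out: "q i = 0" if "n \<le> i" for i using that by (simp add: q_def)
  have r_out: "r i = 0" if "i < n + 1" for i using that by (simp add: r_def)
  have st: "jacobian_det N K = 1" "poly_invertible N K \<Longrightarrow> poly_invertible N F'"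
    by (rule stabilize[where n = n and n' = "n + 1" and N = N and F = F' and q = q and r = r and K = K];
        use \<open>n \<le> n + 1\<close> \<open>n + 1 \<le> N\<close> F'_in F'_out q_in q_out r_in r_out K1 K2 J' in blast)+
  have H: "H i \<in> polys_z N \<and> homogeneous 3 (H i)" if "i < N" for i
  proof (cases "i < n")
    case True
    have "homogeneous (Suc (Suc 1)) (t\<^sup>2 * y i)"
      unfolding power2_eq_square t_def y_def mult.assoc by (intro homogeneous_var_mult homogeneous_var)
    moreover have "homogeneous (Suc 2) (t * P i)"
      unfolding t_def by (intro homogeneous_var_mult P True)
    ultimately have "homogeneous 3 (t\<^sup>2 * y i - t * P i)"
      using homogeneous_add[of 3 "t\<^sup>2 * y i" "- (t * P i)"]
      by (simp add: homogeneous_uminus eval_nat_numeral)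
    moreover have "t \<in> polys_z N" "y i \<in> polys_z N" using True by (auto simp: t_def y_def N_def)
    ultimately show ?thesis using True up'[OF P(1)[OF True]] by (auto simp: H_def intro!: polys_z_closed)
  next
    case False
    then show ?thesis
      using that up'[OF C(1)[of "i - (n + 1)"]] C(2)[of "i - (n + 1)"]
      by (auto simp: H_def r_def N_def intro!: polys_z_closed homogeneous_uminus)
  qed
  have "1 \<le> N" by (simp add: N_def)
  then have "poly_invertible N K"
    using cubic H st(1) unfolding cubic_homogeneous_case_def K_def by blast
  then have "poly_invertible N F'" by (rule st(2))
  then obtain Q where Q: "poly_inverse N F' Q" by (auto simp: poly_invertible_def)
  define \<rho> where "\<rho> j = (if j < n then var (Zv j) else cst (if j = n then 1 else 0))" for j
  have "poly_inverse n F (\<lambda>i. sub \<rho> (Q i))"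
  proof (rule poly_inverse_specialize[OF Q \<open>n \<le> N\<close>])
    show "F' j \<in> polys_z N" if "j < N" for j
      using that F'_in[of j] polys_z_mono[of "n + 1" N] by (cases "j < n") (auto simp: N_def F'_out)
    show "F j = sub \<rho> (F' j)" if "j < n" for j
    proof -
      have "sub \<rho> (P j) = P j" "sub \<rho> (C j) = C j"
        by (rule sub_id[of _ n], use that P C in \<open>simp_all add: \<rho>_def\<close>)+
      then show ?thesis using that by (simp add: F F'_def sub_add sub_mult sub_power t_def \<rho>_def)
    qed
  qed (auto simp: \<rho>_def F'_out)
  then show ?thesis by (auto simp: poly_invertible_def)
qed

section \<open>Lowering the degree\<close>

text \<open>
  The measure for the reduction of the degree: monomials of degree at most 3 do not count, and a
  monomial of degree \<open>d \<ge> 4\<close> outweighs two monomials of degrees \<open>d - 1\<close> and \<open>d - 2\<close> together.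
\<close>
definition excess :: "nat \<Rightarrow> nat" where
  "excess d = (if d \<ge> 4 then 3 ^ d else 0)"

text \<open>
  The total excess of the monomials of a polynomial.
\<close>
definition weight :: "cpoly \<Rightarrow> nat" where
  "weight p = (\<Sum>m\<in>Poly_Mapping.keys p. excess (monom_degree m))"

lemma weight_add: "weight (p + q) \<le> weight p + weight q"
proof -
  have "weight (p + q) \<le> (\<Sum>m\<in>Poly_Mapping.keys p \<union> Poly_Mapping.keys q. excess (monom_degree m))"
    unfolding weight_def by (rule sum_mono2) (use keys_add[of p q] in auto)
  also have "\<dots> \<le> weight p + weight q"
    unfolding weight_def by (simp add: sum_Un_nat)
  finally show ?thesis .
qed

lemma weight_uminus: "weight (- p) = weight p"
proof -
  have "Poly_Mapping.keys (- p) = Poly_Mapping.keys p" by (auto simp: in_keys_iff)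
  then show ?thesis by (simp add: weight_def)
qed

lemma weight_diff: "weight (p - q) \<le> weight p + weight q"
  using weight_add[of p "- q"] by (simp add: weight_uminus)

lemma weight_single: "weight (Poly_Mapping.single m c) \<le> excess (monom_degree m)"
  by (simp add: weight_def)

lemma weight_var: "weight (var v) = 0"
  by (simp add: weight_def var_def excess_def)

lemma weight_remove:
  assumes "m \<in> Poly_Mapping.keys p"
  shows "weight (p - Poly_Mapping.single m (Poly_Mapping.lookup p m)) + excess (monom_degree m) = weight p"
proof -
  have "Poly_Mapping.keys (p - Poly_Mapping.single m (Poly_Mapping.lookup p m)) = Poly_Mapping.keys p - {m}"
    by (auto simp: in_keys_iff lookup_minus lookup_single when_def split: if_splits)
  then show ?thesis
    using assms unfolding weight_def by (simp add: sum.remove[of _ m] add.commute)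
qed

lemma excess_less:
  assumes "d \<ge> 4"
  shows "excess (d - 1) + excess (d - 2) < excess d"
proof -
  have "d = Suc (Suc (d - 2))" using assms by simp
  then obtain e where "d = Suc (Suc e)" by blast
  then show ?thesis using assms by (auto simp: excess_def)
qed

text \<open>
  Induction on the total weight of the components. A monomial \<open>P Q\<close> of degree \<open>d \<ge> 4\<close> with \<open>P\<close> of degree
  2 is exchanged for \<open>- z\<^sub>n Q - z\<^bsub>n+1\<^esub> P - z\<^sub>n z\<^bsub>n+1\<^esub>\<close> and two new components \<open>z\<^sub>n + P\<close> and \<open>z\<^bsub>n+1\<^esub> + Q\<close>. Only
  \<open>z\<^sub>n Q\<close> and \<open>Q\<close> can have positive weight, and their degrees are \<open>d - 1\<close> and \<open>d - 2\<close>.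
\<close>
lemma degree_reduction:
  assumes cubic: cubic_homogeneous_case
    and "\<And>i. i < n \<Longrightarrow> F i \<in> polys_z n" "\<And>i. n \<le> i \<Longrightarrow> F i = var (Zv i)"
    and "\<And>i. i < n \<Longrightarrow> hc 0 (F i) = 0" "\<And>i. i < n \<Longrightarrow> hc 1 (F i) = var (Zv i)"
    and "jacobian_det n F = 1"
  shows "poly_invertible n F"
  using assms(2-)
proof (induction "\<Sum>i<n. weight (F i)" arbitrary: n F rule: less_induct)
  case less
  note F_in = less.prems(1) and F_out = less.prems(2) and F0 = less.prems(3) and F1 = less.prems(4)
    and J = less.prems(5)
  show ?case
  proof (cases "\<forall>i<n. \<forall>m\<in>Poly_Mapping.keys (F i). monom_degree m < 4")
    case True
    show ?thesis
    proof (rule quadratic_cubic_invertible[OF cubic, where P = "\<lambda>i. hc 2 (F i)" and C = "\<lambda>i. hc 3 (F i)"])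
      fix i assume i: "i < n"
      have "hc d (F i) = 0" if "d \<ge> 4" for d
        by (rule poly_mapping_eqI) (use True i that in \<open>force simp: lookup_hc in_keys_iff\<close>)
      then have "F i = (\<Sum>d<4. hc d (F i))" by (simp add: sum_hc)
      then show "F i = var (Zv i) + hc 2 (F i) + hc 3 (F i)"
        using F0[OF i] F1[OF i] by (simp add: eval_nat_numeral)
    qed (auto simp: J F_in polys_z_hc homogeneous_hc)
  next
    case False
    then obtain i0 m0 where i0: "i0 < n" and m0: "m0 \<in> Poly_Mapping.keys (F i0)" and d: "monom_degree m0 \<ge> 4"
      by (auto simp: not_less)
    define c where "c = Poly_Mapping.lookup (F i0) m0"
    have m0_keys: "Poly_Mapping.keys m0 \<subseteq> Zv ` {..<n}"
      using F_in[OF i0] m0 by (auto simp: polys_z_def polys_in_def)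
    have split: "\<exists>v k. m = Poly_Mapping.single v 1 + k \<and> monom_degree m = Suc (monom_degree k)"
      if "monom_degree m \<noteq> 0" for m
    proof -
      have "m \<noteq> 0" using that by auto
      then obtain v where "Poly_Mapping.lookup m v \<noteq> 0" by (metis poly_mapping_eqI lookup_zero)
      from monom_split[OF this] show ?thesis by (metis monom_degree_add monom_degree_single plus_1_eq_Suc)
    qed
    obtain v k where vk: "m0 = Poly_Mapping.single v 1 + k" "monom_degree m0 = Suc (monom_degree k)"
      using split[of m0] d by (metis not_numeral_le_zero)
    obtain v' k' where vk': "k = Poly_Mapping.single v' 1 + k'" "monom_degree k = Suc (monom_degree k')"
      using split[of k] d vk(2) by fastforce
    define p where "p = Poly_Mapping.single v 1 + Poly_Mapping.single v' (1::nat)"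
    have m0_eq: "m0 = p + k'" using vk vk' by (simp add: p_def add.assoc)
    have deg_p: "monom_degree p = 2" by (simp add: p_def monom_degree_add)
    have deg_k': "monom_degree k' = monom_degree m0 - 2" using vk vk' by simp
    have keys_p: "Poly_Mapping.keys p \<subseteq> Zv ` {..<n}" and keys_k': "Poly_Mapping.keys k' \<subseteq> Zv ` {..<n}"
      using m0_keys by (auto simp: m0_eq keys_add_nat)
    define P where "P = Poly_Mapping.single p (1::complex)"
    define Q where "Q = Poly_Mapping.single k' c"
    have PQ_in: "P \<in> polys_z n" "Q \<in> polys_z n"
      using keys_p keys_k' by (auto simp: P_def Q_def polys_z_def polys_in_def)
    have PQ: "P * Q = Poly_Mapping.single m0 c" by (simp add: P_def Q_def mult_single m0_eq)
    define q where "q i = (if i = i0 then - (var (Zv n) * var (Zv (n + 1))) else 0)" for i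
    define r where "r i = (if i = n then P else if i = n + 1 then Q else 0)" for i
    define K where "K i = (if i < n then F i + sub (\<lambda>i. var (Zv i) + r i) (q i) else var (Zv i) + r i)" for i
    have n: "n \<le> n" "n \<le> n + 2" by simp_all
    have q_in: "q i \<in> polys_in (Zv ` {n..<n + 2})" for i
      by (auto simp: q_def intro!: polys_in_closed)
    have q_out: "q i = 0" if "n \<le> i" for i using that i0 by (simp add: q_def)
    have r_in: "r i \<in> polys_z n" for i by (simp add: r_def PQ_in)
    have r_out: "r i = 0" if "i < n" for i using that by (simp add: r_def)
    have K1: "K i = F i + sub (\<lambda>i. var (Zv i) + r i) (q i)" if "i < n" for i using that by (simp add: K_def)
    have K2: "K i = var (Zv i) + r i" if "n \<le> i" for i using that by (simp add: K_def)
    have st: "jacobian_det (n + 2) K = 1" "poly_invertible (n + 2) K \<Longrightarrow> poly_invertible (n + 2) F"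
      by (rule stabilize[where n = n and n' = n and N = "n + 2" and F = F and q = q and r = r and K = K];
          use n F_in F_out q_in q_out r_in r_out K1 K2 J in blast)+
    let ?zQ = "var (Zv n) * Q" and ?zP = "var (Zv (n + 1)) * P" and ?zz = "var (Zv n) * var (Zv (n + 1))"
    have zQ: "?zQ = Poly_Mapping.single (Poly_Mapping.single (Zv n) 1 + k') c"
      and zP: "?zP = Poly_Mapping.single (Poly_Mapping.single (Zv (n + 1)) 1 + p) 1"
      and zz: "?zz = Poly_Mapping.single (Poly_Mapping.single (Zv n) 1 + Poly_Mapping.single (Zv (n + 1)) 1) 1"
      by (simp_all add: var_def P_def Q_def mult_single)
    have K_other: "K i = F i" if "i < n" "i \<noteq> i0" for i using that by (simp add: K_def q_def)
    have K_i0: "K i0 = (F i0 - Poly_Mapping.single m0 c) - ?zQ - ?zP - ?zz"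
      using i0 unfolding PQ[symmetric]
      by (simp add: K_def q_def r_def sub_uminus sub_mult algebra_simps)
    have small: "weight (Poly_Mapping.single m a) = 0" if "monom_degree m < 4" for m a
      using weight_single[of m a] that by (simp add: excess_def)
    have wt_zP: "weight ?zP = 0" and wt_zz: "weight ?zz = 0"
      unfolding zP zz by (rule small, simp add: monom_degree_add deg_p)+
    have wt_P: "weight P = 0" unfolding P_def by (rule small) (simp add: deg_p)
    have "Suc (monom_degree m0 - 2) = monom_degree m0 - 1" using d by simp
    then have wt_zQ: "weight ?zQ \<le> excess (monom_degree m0 - 1)"
      unfolding zQ using weight_single[of "Poly_Mapping.single (Zv n) 1 + k'" c]
      by (simp add: monom_degree_add deg_k')
    have wt_Q: "weight Q \<le> excess (monom_degree m0 - 2)"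
      unfolding Q_def using weight_single[of k' c] by (simp add: deg_k')
    have wt_i0: "weight (K i0) + excess (monom_degree m0) \<le> weight (F i0) + excess (monom_degree m0 - 1)"
    proof -
      have "weight (K i0) \<le> weight (F i0 - Poly_Mapping.single m0 c) + weight ?zQ + weight ?zP + weight ?zz"
        unfolding K_i0 by (intro order_trans[OF weight_diff] add_mono order_refl)
      then show ?thesis using weight_remove[OF m0] wt_zQ wt_zP wt_zz by (simp add: c_def)
    qed
    have wt_n: "weight (K n) = 0" "weight (K (n + 1)) \<le> excess (monom_degree m0 - 2)"
      using weight_add[of "var (Zv n)" P] weight_add[of "var (Zv (n + 1))" Q] wt_P wt_Q
      by (auto simp: K_def r_def weight_var)
    have "(\<Sum>i<n + 2. weight (K i)) =
        (\<Sum>i\<in>{..<n} - {i0}. weight (K i)) + weight (K i0) + weight (K n) + weight (K (n + 1))"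
      using i0 by (simp add: sum.remove[of "{..<n}" i0])
    also have "(\<Sum>i\<in>{..<n} - {i0}. weight (K i)) = (\<Sum>i\<in>{..<n} - {i0}. weight (F i))"
      by (rule sum.cong) (auto simp: K_other)
    also have "\<dots> + weight (K i0) + weight (K n) + weight (K (n + 1)) <
        (\<Sum>i\<in>{..<n} - {i0}. weight (F i)) + weight (F i0)"
      using wt_i0 wt_n excess_less[OF d] by linarith
    also have "\<dots> = (\<Sum>i<n. weight (F i))"
      using i0 by (simp add: sum.remove[of "{..<n}" i0])
    finally have wt: "(\<Sum>i<n + 2. weight (K i)) < (\<Sum>i<n. weight (F i))" .
    have hc_K: "hc e (K i) = hc e (var (Zv i))" if "i < n + 2" "e \<le> 1" for e i
    proof -
      have F: "hc e (F i) = hc e (var (Zv i))" if "i < n" for i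
      proof (cases "e = 0")
        case True
        then show ?thesis using F0[OF that] by (simp add: hc_var)
      next
        case False
        then have "e = 1" using \<open>e \<le> 1\<close> by simp
        then show ?thesis using F1[OF that] by (simp add: hc_var)
      qed
      have "hc e (Poly_Mapping.single m0 c) = 0" "hc e ?zQ = 0" "hc e ?zP = 0" "hc e ?zz = 0"
        unfolding zQ zP zz hc_single using d \<open>e \<le> 1\<close> by (auto simp: monom_degree_add deg_p deg_k')
      moreover have "hc e P = 0" "hc e Q = 0"
        unfolding P_def Q_def hc_single using d \<open>e \<le> 1\<close> by (auto simp: deg_p deg_k')
      ultimately have "hc e (K i0) = hc e (var (Zv i0))" "hc e (K n) = hc e (var (Zv n))"
        "hc e (K (n + 1)) = hc e (var (Zv (n + 1)))"
        using F[OF i0] by (simp_all only: K_i0 hc_diff diff_zero K2 r_def hc_add refl if_True le_add1 order_refl)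
          (simp_all add: hc_add)
      moreover have "i = i0 \<or> i = n \<or> i = n + 1 \<or> (i < n \<and> i \<noteq> i0)" using that i0 by linarith
      ultimately show ?thesis using F K_other by metis
    qed
    have K_in: "K i \<in> polys_z (n + 2)" if "i < n + 2" for i
    proof (cases "i < n")
      case True
      have "q i \<in> polys_z (n + 2)" using q_in[of i] polys_in_mono[of "Zv ` {n..<n + 2}" "Zv ` {..<n + 2}"]
        by (force simp: polys_z_def)
      then have "sub (\<lambda>i. var (Zv i) + r i) (q i) \<in> polys_z (n + 2)"
        using polys_z_mono[OF n(2) r_in] by (intro polys_z_sub[of _ "n + 2"]) (auto intro!: polys_z_closed)
      then show ?thesis
        using True polys_z_mono[OF n(2) F_in[OF True]] by (simp add: K1 polys_z_closed)
    next
      case False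
      then show ?thesis using that polys_z_mono[OF n(2) r_in[of i]] by (simp add: K2 polys_z_closed)
    qed
    have "poly_invertible (n + 2) K"
    proof (rule less.hyps[OF wt])
      show "K i = var (Zv i)" if "n + 2 \<le> i" for i using that by (simp add: K2 r_def)
    qed (use K_in hc_K st(1) in \<open>simp_all add: hc_var\<close>)
    then have "poly_invertible (n + 2) F" by (rule st(2))
    then obtain G where G: "poly_inverse (n + 2) F G" by (auto simp: poly_invertible_def)
    define \<rho> where "\<rho> j = (if j < n then var (Zv j) else cst 0)" for j
    have "poly_inverse n F (\<lambda>i. sub \<rho> (G i))"
    proof (rule poly_inverse_specialize[OF G n(2), where c = "\<lambda>_. 0"])
      show "F j \<in> polys_z (n + 2)" if "j < n + 2" for j
        using that polys_z_mono[OF n(2) F_in[of j]] F_out[of j] by (cases "j < n") simp_all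
      show "F j = sub \<rho> (F j)" if "j < n" for j
        using sub_id[OF F_in[OF that], of \<rho>] by (simp add: \<rho>_def)
    qed (use F_out in \<open>auto simp: \<rho>_def\<close>)
    then show ?thesis by (auto simp: poly_invertible_def)
  qed
qed

section \<open>Affine normalisation\<close>

text \<open>
  The constant coefficient, as the value at the origin.
\<close>
definition const_coeff :: "cpoly \<Rightarrow> complex" where
  "const_coeff = psub (\<lambda>c. c) (\<lambda>_. 0)"

lemma comm_ring_hom_id: "comm_ring_hom (\<lambda>c :: complex. c)"
  by unfold_locales simp_all

lemma comm_ring_hom_const_coeff: "comm_ring_hom const_coeff"
  unfolding const_coeff_def by (rule comm_ring_hom_psub[OF comm_ring_hom_id])

lemma const_coeff_simps [simp]: "const_coeff (cst c) = c" "const_coeff (var v) = 0"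
  by (simp_all add: const_coeff_def psub_cst[OF comm_ring_hom_id] psub_var[OF comm_ring_hom_id])

lemma const_coeff_add: "const_coeff (p + q) = const_coeff p + const_coeff q"
  and const_coeff_mult: "const_coeff (p * q) = const_coeff p * const_coeff q"
  by (simp_all add: const_coeff_def psub_add[OF comm_ring_hom_id] psub_mult[OF comm_ring_hom_id])

lemma cst_add: "cst (a + b) = cst a + cst b"
  and cst_mult: "cst (a * b) = cst a * cst b"
  and cst_sum: "cst (sum g A) = (\<Sum>i\<in>A. cst (g i))"
proof -
  interpret comm_ring_hom cst by (rule comm_ring_hom_cst)
  show "cst (a + b) = cst a + cst b" "cst (a * b) = cst a * cst b" "cst (sum g A) = (\<Sum>i\<in>A. cst (g i))"
    by (simp_all add: hom_distribs)
qed

lemma hc_0_eq: "hc 0 p = cst (const_coeff p)"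
  by (induction p rule: cpoly_induct)
    (simp_all add: hc_cst hc_var hc_add hc_mult const_coeff_add const_coeff_mult cst_add cst_mult)

text \<open>
  The linear part is given by the gradient at the origin.
\<close>
lemma hc_1_eq:
  assumes "p \<in> polys_z n"
  shows "hc 1 p = (\<Sum>j<n. cst (const_coeff (pdiff (Zv j) p)) * var (Zv j))"
  using assms
proof (induction p rule: polys_z_induct)
  case (cst c)
  have "const_coeff 0 = 0" using const_coeff_simps(1)[of 0] by simp
  then show ?case by (simp add: hc_cst)
next
  case (var i)
  have "const_coeff 1 = 1" "const_coeff 0 = 0" using const_coeff_simps(1)[of 0] const_coeff_simps(1)[of 1] by simp_all
  then have "(\<Sum>j<n. cst (const_coeff (pdiff (Zv j) (var (Zv i)))) * var (Zv j)) =
      (\<Sum>j<n. if j = i then var (Zv j) else 0)"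
    by (intro sum.cong) (auto simp: pdiff_var)
  then show ?case using var by (simp add: hc_var)
next
  case (add p q)
  then show ?case by (simp add: hc_add pdiff_add const_coeff_add cst_add ring_distribs sum.distrib)
next
  case (mult p q)
  have "hc 1 (p * q) = hc 0 p * hc 1 q + hc 1 p * hc 0 q"
    by (simp add: hc_mult)
  then show ?case
    unfolding mult.IH hc_0_eq
    by (simp add: pdiff_mult const_coeff_add const_coeff_mult cst_add cst_mult ring_distribs
        sum.distrib sum_distrib_left sum_distrib_right mult_ac)
qed

lemma sum_matrix_inverse:
  assumes A: "A \<in> carrier_mat n n" "B \<in> carrier_mat n n" "A * B = 1\<^sub>m n" and i: "i < n"
  shows "(\<Sum>j<n. cst (A $$ (i, j)) * (\<Sum>k<n. cst (B $$ (j, k)) * x k)) = x i"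
proof -
  have AB: "(\<Sum>j<n. A $$ (i, j) * B $$ (j, k)) = (if i = k then 1 else 0)" if "k < n" for k
  proof -
    have "(A * B) $$ (i, k) = (\<Sum>j<n. A $$ (i, j) * B $$ (j, k))"
      using A(1,2) i that by (auto simp: scalar_prod_def lessThan_atLeast0)
    then show ?thesis using A(3) i that by simp
  qed
  have "(\<Sum>j<n. cst (A $$ (i, j)) * (\<Sum>k<n. cst (B $$ (j, k)) * x k)) =
      (\<Sum>k<n. cst (\<Sum>j<n. A $$ (i, j) * B $$ (j, k)) * x k)"
    unfolding sum_distrib_left by (subst sum.swap) (simp add: cst_sum cst_mult sum_distrib_right mult.assoc)
  also have "\<dots> = (\<Sum>k<n. if k = i then x k else 0)"
    by (rule sum.cong) (auto simp: AB)
  also have "\<dots> = x i" using i by simp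
  finally show ?thesis .
qed

text \<open>
  With the Jacobian matrix \<open>M\<close> of \<open>F\<close> at the origin, the affine map \<open>T = M\<^sup>-\<^sup>1 (z - F(0))\<close> makes \<open>T \<circ> F\<close>
  tangent to the identity at the origin, so that \<open>degree_reduction\<close> applies.
\<close>
theorem cubic_reduction:
  assumes cubic: cubic_homogeneous_case
    and F: "\<And>i. i < n \<Longrightarrow> F i \<in> polys_z n" and J: "jacobian_det n F = 1"
  shows "poly_invertible n F"
proof -
  have smult_one: "1 \<cdot>\<^sub>m M = M" for M :: "complex mat" by (rule eq_matI) simp_all
  interpret cc: comm_ring_hom const_coeff by (rule comm_ring_hom_const_coeff)
  define A where "A = map_mat const_coeff (jac_mat n F)"
  define B where "B = adj_mat A"
  define c where "c j = const_coeff (F j)" for j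
  have A: "A \<in> carrier_mat n n" by (simp add: A_def)
  have "det A = 1" using J by (simp add: A_def jacobian_det_eq cc.hom_det)
  then have B: "B \<in> carrier_mat n n" and AB: "A * B = 1\<^sub>m n" "B * A = 1\<^sub>m n"
    using adj_mat[OF A] smult_one[of "1\<^sub>m n"] by (simp_all add: B_def)
  have "det A * det B = 1" using det_mult[OF A B] AB by simp
  then have det_B: "det B = 1" using \<open>det A = 1\<close> by simp
  define T where "T i = (\<Sum>j<n. cst (B $$ (i, j)) * (var (Zv j) - cst (c j)))" for i
  define T' where "T' i = (\<Sum>j<n. cst (A $$ (i, j)) * var (Zv j)) + cst (c i)" for i
  have T_in: "T i \<in> polys_z n" and T'_in: "T' i \<in> polys_z n" for i
    by (auto simp: T_def T'_def intro!: polys_z_closed)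
  have sub_T': "sub G (T' i) = (\<Sum>j<n. cst (A $$ (i, j)) * G j) + cst (c i)" for G i
    by (simp add: T'_def sub_add sub_sum sub_mult)
  have sub_T: "sub G (T i) = (\<Sum>j<n. cst (B $$ (i, j)) * (G j - cst (c j)))" for G i
    by (simp add: T_def sub_diff sub_sum sub_mult)
  have inv: "poly_inverse n T' T"
    unfolding poly_inverse_def
  proof (intro allI impI conjI T_in)
    fix i assume i: "i < n"
    show "sub T' (T i) = var (Zv i)"
      using sum_matrix_inverse[OF B A AB(2) i] by (simp add: sub_T T'_def)
    show "sub T (T' i) = var (Zv i)"
      using sum_matrix_inverse[OF A B AB(1) i, of "\<lambda>k. var (Zv k) - cst (c k)"] by (simp add: sub_T' T_def)
  qed
  define F' where "F' i = (if i < n then sub F (T i) else var (Zv i))" for i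
  have F'_in: "F' i \<in> polys_z n" if "i < n" for i
    using that by (auto simp: F'_def intro!: polys_z_sub[OF T_in] F)
  have "poly_invertible n F'"
  proof (rule degree_reduction[OF cubic F'_in])
    show "F' i = var (Zv i)" if "n \<le> i" for i using that by (simp add: F'_def)
    show "hc 0 (F' i) = 0" if "i < n" for i
      using that by (simp add: F'_def sub_T hc_sum hc_cst_mult hc_diff hc_0_eq c_def)
    show "hc 1 (F' i) = var (Zv i)" if i: "i < n" for i
    proof -
      have "hc 1 (F j) = (\<Sum>k<n. cst (A $$ (j, k)) * var (Zv k))" if "j < n" for j
        using hc_1_eq[OF F[OF that]] that by (simp add: A_def)
      then have "hc 1 (F' i) = (\<Sum>j<n. cst (B $$ (i, j)) * (\<Sum>k<n. cst (A $$ (j, k)) * var (Zv k)))"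
        using i by (simp add: F'_def sub_T hc_sum hc_cst_mult hc_diff hc_cst)
      also have "\<dots> = var (Zv i)" by (rule sum_matrix_inverse[OF B A AB(2) i])
      finally show ?thesis .
    qed
    have "jac_mat n T = map_mat cst B"
    proof (rule eq_matI)
      fix i j assume "i < dim_row (map_mat cst B)" "j < dim_col (map_mat cst B)"
      then have ij: "i < n" "j < n" using B by auto
      have "pdiff (Zv j) (T i) = (\<Sum>k<n. if k = j then cst (B $$ (i, k)) else 0)"
        unfolding T_def pdiff_sum by (rule sum.cong) (auto simp: pdiff_cst_mult pdiff_diff pdiff_var)
      then show "jac_mat n T $$ (i, j) = map_mat cst B $$ (i, j)" using ij B by simp
    qed (use B in auto)
    then have J_T: "jacobian_det n T = 1"
      by (simp add: jacobian_det_eq comm_ring_hom.hom_det[OF comm_ring_hom_cst] det_B)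
    have "jacobian_det n F' = jacobian_det n (\<lambda>i. sub F (T i))"
      by (rule jacobian_det_cong) (simp add: F'_def)
    also have "\<dots> = 1" by (simp add: jacobian_det_sub T_in J_T J)
    finally show "jacobian_det n F' = 1" .
  qed
  then obtain G where G: "poly_inverse n F' G" by (auto simp: poly_invertible_def)
  have F_eq: "F i = sub F' (T' i)" if i: "i < n" for i
  proof -
    have "sub F' (T' i) = (\<Sum>j<n. cst (A $$ (i, j)) * (\<Sum>k<n. cst (B $$ (j, k)) * (F k - cst (c k)))) + cst (c i)"
      by (simp add: sub_T' F'_def sub_T)
    also have "\<dots> = F i"
      using sum_matrix_inverse[OF A B AB(1) i, of "\<lambda>k. F k - cst (c k)"] by simp
    finally show ?thesis by simp
  qed
  show ?thesis
    using poly_inverse_cong[OF poly_inverse_comp[OF inv T'_in G F'_in] F_eq] by (auto simp: poly_invertible_def)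
qed

section \<open>Polynomial maps as functions\<close>

lemma eval_poly_simps [simp]: "eval_poly a (cst c) = c" "eval_poly a (var v) = a v"
  and eval_poly_add: "eval_poly a (p + q) = eval_poly a p + eval_poly a q"
  and eval_poly_mult: "eval_poly a (p * q) = eval_poly a p * eval_poly a q"
  by (simp_all add: eval_poly_eq_psub psub_cst[OF comm_ring_hom_id] psub_var[OF comm_ring_hom_id]
      psub_add[OF comm_ring_hom_id] psub_mult[OF comm_ring_hom_id])

lemma eval_poly_diff: "eval_poly a (p - q) = eval_poly a p - eval_poly a q"
  using eval_poly_add[of a "p - q" q] by simp

lemma eval_poly_0 [simp]: "eval_poly a 0 = 0" and eval_poly_1 [simp]: "eval_poly a 1 = 1"
  using eval_poly_simps(1)[of a 0] eval_poly_simps(1)[of a 1] by simp_all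

lemma eval_poly_cong:
  assumes "p \<in> polys_in V" "\<And>v. v \<in> V \<Longrightarrow> a v = b v"
  shows "eval_poly a p = eval_poly b p"
  using assms(1) by (induction p rule: polys_in_induct) (simp_all add: assms(2) eval_poly_add eval_poly_mult)

text \<open>
  If \<open>p\<close> vanishes everywhere, its restriction to the line through \<open>a\<close> in the direction of \<open>v\<close> is a
  univariate polynomial that vanishes everywhere, hence zero, and so is its derivative.
\<close>
lemma eval_poly_pdiff_zero:
  assumes "\<And>a. eval_poly a p = 0"
  shows "eval_poly a (pdiff v p) = 0"
proof -
  have hom: "comm_ring_hom (\<lambda>c :: complex. [:c:])"
    by unfold_locales (simp_all add: one_pCons)
  define P where "P q = psub (\<lambda>c. [:c:]) (\<lambda>w. if w = v then [:a v, 1:] else [:a w:]) q" for q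
  have P: "P (cst c) = [:c:]" "P (var w) = (if w = v then [:a v, 1:] else [:a w:])"
      "P (q + q') = P q + P q'" "P (q * q') = P q * P q'" for c w q q'
    by (simp_all add: P_def psub_cst[OF hom] psub_var[OF hom] psub_add[OF hom] psub_mult[OF hom])
  have eval: "poly (P q) s = eval_poly (a(v := a v + s)) q" for q s
    by (induction q rule: cpoly_induct) (simp_all add: P eval_poly_add eval_poly_mult)
  have eval0: "poly (P q) 0 = eval_poly a q" for q by (simp add: eval)
  have deriv: "poly (pderiv (P q)) 0 = eval_poly a (pdiff v q)" for q
    by (induction q rule: cpoly_induct)
      (simp_all add: P pderiv_add pderiv_mult pdiff_var pdiff_add pdiff_mult
        eval_poly_add eval_poly_mult eval0 pderiv_pCons)
  have "P p = 0" using assms by (intro poly_eq_poly_eq_iff[THEN iffD1]) (simp add: fun_eq_iff eval)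
  then show ?thesis using deriv[of p] by simp
qed

text \<open>
  By induction on the degree: the partial derivatives vanish everywhere as well, hence are zero, so
  that the polynomial is constant.
\<close>
lemma eval_poly_zero_imp_zero:
  assumes "\<And>a. eval_poly a p = 0"
  shows "p = 0"
proof -
  obtain K where "\<forall>d\<ge>K. hc d p = 0" using hc_bound by blast
  then show ?thesis using assms
  proof (induction K arbitrary: p)
    case 0
    then show ?case by (metis hc_eqI hc_0 le0)
  next
    case (Suc K)
    have "pdiff v p = 0" for v
      using Suc.prems by (intro Suc.IH eval_poly_pdiff_zero) (simp_all add: hc_pdiff)
    then have "p = hc 0 p" by (intro pdiff_all_zero[of _ UNIV]) simp_all
    then have p: "p = cst (const_coeff p)" by (simp only: hc_0_eq)
    have "const_coeff p = 0" using Suc.prems(2)[of "\<lambda>_. 0"] by (subst (asm) p) simp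
    then show ?case using p by simp
  qed
qed

text \<open>
  The assignment of values that belongs to a point of \<open>\<complex>\<^sup>n\<close>.
\<close>
definition point :: "complex vec \<Rightarrow> pvar \<Rightarrow> complex" where
  "point x = (\<lambda>v. case v of Xi j \<Rightarrow> 0 | Zv j \<Rightarrow> x $ j)"

lemma poly_map_eq: "poly_map n P x = vec n (\<lambda>i. eval_poly (point x) (P i))"
  by (simp add: poly_map_def point_def)

lemma eval_poly_sub:
  assumes "p \<in> polys_z n"
  shows "eval_poly (point x) (sub P p) = eval_poly (point (poly_map n P x)) p"
  using assms
  by (induction p rule: polys_z_induct)
    (simp_all add: sub_add sub_mult eval_poly_add eval_poly_mult poly_map_eq point_def)

lemma polys_z_eqI:
  assumes "p \<in> polys_z n" "q \<in> polys_z n"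
    and eq: "\<And>x. x \<in> carrier_vec n \<Longrightarrow> eval_poly (point x) p = eval_poly (point x) q"
  shows "p = q"
proof -
  have "eval_poly a (p - q) = 0" for a
  proof -
    have "eval_poly a (p - q) = eval_poly (point (vec n (\<lambda>i. a (Zv i)))) (p - q)"
      by (rule eval_poly_cong[of _ "Zv ` {..<n}"])
        (use assms in \<open>auto simp: polys_z_def point_def intro: polys_in_closed\<close>)
    then show ?thesis by (simp add: eq eval_poly_diff)
  qed
  then have "p - q = 0" by (rule eval_poly_zero_imp_zero)
  then show ?thesis by simp
qed

lemma poly_automorphism_iff:
  assumes P: "\<And>i. i < n \<Longrightarrow> P i \<in> polys_z n"
  shows "poly_automorphism n P \<longleftrightarrow> poly_invertible n P"
proof -
  have *: "(\<forall>x\<in>carrier_vec n. poly_map n Q (poly_map n P x) = x) \<longleftrightarrow>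
      (\<forall>i<n. sub P (Q i) = var (Zv i))"
    if "\<And>i. i < n \<Longrightarrow> P i \<in> polys_z n" "\<And>i. i < n \<Longrightarrow> Q i \<in> polys_z n" for P Q
  proof (intro iffI allI impI ballI)
    fix i assume *: "\<forall>x\<in>carrier_vec n. poly_map n Q (poly_map n P x) = x" and i: "i < n"
    show "sub P (Q i) = var (Zv i)"
    proof (rule polys_z_eqI[of _ n])
      show "sub P (Q i) \<in> polys_z n" using i that by (intro polys_z_sub[of _ n])
      show "var (Zv i) \<in> polys_z n" using i by simp
      fix x :: "complex vec" assume x: "x \<in> carrier_vec n"
      have "eval_poly (point x) (sub P (Q i)) = poly_map n Q (poly_map n P x) $ i"
        using i that by (simp add: eval_poly_sub[of _ n] poly_map_eq[of n Q])
      also have "\<dots> = x $ i" using * x by simp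
      finally show "eval_poly (point x) (sub P (Q i)) = eval_poly (point x) (var (Zv i))"
        by (simp add: point_def)
    qed
  next
    fix x :: "complex vec" assume *: "\<forall>i<n. sub P (Q i) = var (Zv i)" and x: "x \<in> carrier_vec n"
    show "poly_map n Q (poly_map n P x) = x"
    proof (rule eq_vecI)
      fix i assume "i < dim_vec x"
      then have i: "i < n" using x by simp
      have "poly_map n Q (poly_map n P x) $ i = eval_poly (point x) (sub P (Q i))"
        using i that by (simp add: eval_poly_sub[of _ n] poly_map_eq[of n Q])
      then show "poly_map n Q (poly_map n P x) $ i = x $ i" using * i by (simp add: point_def)
    qed (use x in \<open>simp add: poly_map_eq\<close>)
  qed
  show ?thesis
    unfolding poly_automorphism_def poly_invertible_def poly_inverse_def
  proof (rule ex_cong1)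
    fix Q
    show "((\<forall>i<n. Q i \<in> polys_z n) \<and>
        (\<forall>x\<in>carrier_vec n. poly_map n Q (poly_map n P x) = x \<and> poly_map n P (poly_map n Q x) = x)) \<longleftrightarrow>
      (\<forall>i<n. Q i \<in> polys_z n \<and> sub P (Q i) = var (Zv i) \<and> sub Q (P i) = var (Zv i))"
      using *[of P Q] *[of Q P] P by blast
  qed
qed

section \<open>The equivalence\<close>

theorem theorem3p7:
  shows "(\<forall>n\<ge>1. jacobian_conjecture n) \<longleftrightarrow>
    (\<forall>n\<ge>1. \<forall>H :: nat \<Rightarrow> cpoly.
       (\<forall>i<n. H i \<in> polys_z n \<and> homogeneous 3 (H i)) \<longrightarrow>
       (\<forall>j<n. image_conjecture_for n (\<Sum>i<n. var (Xi i) * H i) (var (Zv j))))"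
proof -
  have image: "(\<forall>j<n. image_conjecture_for n (\<Sum>i<n. var (Xi i) * H i) (var (Zv j))) \<longleftrightarrow>
      (jacobian_det n (\<lambda>i. var (Zv i) - H i) = 1 \<longrightarrow> poly_invertible n (\<lambda>i. var (Zv i) - H i))"
    if "\<forall>i<n. H i \<in> polys_z n \<and> homogeneous 3 (H i)" for n H
  proof -
    interpret cubic_map n H by standard (use that in auto)
    have "F = (\<lambda>i. var (Zv i) - H i)" by (simp add: F_def fun_eq_iff)
    then show ?thesis using image_conjecture_iff by (simp add: f_def poly_invertible_def)
  qed
  have "(\<forall>n\<ge>1. jacobian_conjecture n) \<longleftrightarrow> cubic_homogeneous_case"
  proof
    assume JC: "\<forall>n\<ge>1. jacobian_conjecture n"
    show cubic_homogeneous_case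
      unfolding cubic_homogeneous_case_def
    proof (intro allI impI)
      fix n H
      assume n: "1 \<le> n" and H: "\<forall>i<n. H i \<in> polys_z n \<and> homogeneous 3 (H i)"
        and J: "jacobian_det n (\<lambda>i. var (Zv i) - H i) = 1"
      have in_z: "var (Zv i) - H i \<in> polys_z n" if "i < n" for i
        using H that by (auto intro: polys_z_closed)
      then have "poly_automorphism n (\<lambda>i. var (Zv i) - H i)"
        using JC[rule_format, OF n, unfolded jacobian_conjecture_def, THEN spec, of "\<lambda>i. var (Zv i) - H i"] J
        by simp
      then show "poly_invertible n (\<lambda>i. var (Zv i) - H i)"
        by (simp add: poly_automorphism_iff in_z)
    qed
  next
    assume cubic: cubic_homogeneous_case
    show "\<forall>n\<ge>1. jacobian_conjecture n"
      unfolding jacobian_conjecture_def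
      by (simp add: poly_automorphism_iff cubic_reduction[OF cubic])
  qed
  then show ?thesis using image unfolding cubic_homogeneous_case_def by blast
qed

end
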